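(* Let $L^*\in\mathcal S_{[N]}^{++}$ be block diagonal, let $Z_1,Z_2,\dots$ be i.i.d. with distribution $\mathsf{DPP}(L^* )$, and for each $n$ let $\hat L=\hat L_n\in\mathcal S_{[N]}^{++}$ be a maximum likelihood estimator of $L^*$ based on $Z_1,\dots,Z_n$. Then, for any pair of distinct blocks $J$ and $J'$ of $L^*$, as $n\to\infty$, $$\min_{D\in\mathcal D}\|\hat L_{J,J'}-DL^*_{J,J'}D\|_F=O_{\mathbb P}(n^{-1/6})$$ and $$\min_{D\in\mathcal D}\|\hat L_J-DL^*_JD\|_F=O_{\mathbb P}(n^{-1/2}).$$
   Context: Fix a positive integer $N$ (not depending on $n$) and let $[N]=\{1,\dots,N\}$. $\mathcal S_{[N]}^{++}$ is the set of real symmetric positive definite $N\times N$ matrices and $\|\cdot\|_F$ is the Frobenius norm. $\mathcal D$ is the set of $N\times N$ diagonal matrices with diagonal entries in $\{-1,1\}$. For an $N\times N$ matrix $A$ and $J,J'\subseteq[N]$, $A_{J,J'}$ is the $N\times N$ matrix whose $(i,j)$ entry is $A_{i,j}$ if $(i,j)\in J\times J'$ and $0$ otherwise. $A_J$ is the restriction of $A$ to $J\times J$; in the norm above it is regarded as the $N\times N$ matrix $A_{J,J}$, while in determinants it is the $|J|\times|J|$ matrix, with $\det A_\emptyset=1$. For $L\in\mathcal S_{[N]}^{++}$, $\mathsf{DPP}(L)$ is the probability distribution on subsets of $[N]$ given by $p_J(L)=\mathbb P[Z=J]=\det(L_J)/\det(I+L)$, $J\subseteq[N]$. Given $Z_1,\dots,Z_n$,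 the (scaled) log-likelihood is $\hat\Phi(L)=\frac1n\sum_{i=1}^n\log p_{Z_i}(L)$, $L\in\mathcal S_{[N]}^{++}$. A maximum likelihood estimator (MLE) $\hat L$ is any (measurable, $\mathcal S_{[N]}^{++}$-valued) maximizer of $\hat\Phi$ over $\mathcal S_{[N]}^{++}$ (maximizers are in general not unique); on the event that $\hat\Phi$ has no maximizer in $\mathcal S_{[N]}^{++}$, $\hat L$ may take an arbitrary value. A symmetric matrix $A$ is block diagonal if there is a partition $\{J_1,\dots,J_k\}$, $k\ge1$, of $[N]$ such that $A_{i,j}=0$ whenever $i\in J_a$, $j\in J_b$, $a\ne b$; for the largest such $k$, the sets $J_1,\dots,J_k$ are called the blocks of $A$ (equivalently, they are the connected components of the graph on $[N]$ with edges $\{i,j\}$ for $A_{i,j}\neq0$). $X_n=O_{\mathbb P}(r_n)$ means that the sequence $X_n/r_n$ is bounded in probability. *)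

theory Defs
  imports "HOL-Probability.Probability" "HOL-Combinatorics.Permutations"
    "HOL-Library.Disjoint_Sets"
begin

text \<open>
  The index set \<open>[N]\<close> is a finite type \<open>'n\<close>, so \<open>N = CARD('n) \<ge> 1\<close>. On
  \<open>real ^ 'n ^ 'n\<close> the library's \<open>norm\<close> is the square root of the sum of the squares of
  all entries, i.e. the Frobenius norm.
\<close>

definition spd :: "(real ^ 'n ^ 'n) set" where
  "spd = {A. transpose A = A \<and> (\<forall>x. x \<noteq> 0 \<longrightarrow> x \<bullet> (A *v x) > 0)}"

definition sign_matrices :: "(real ^ 'n ^ 'n) set" where
  "sign_matrices = {D. \<forall>i j. (i \<noteq> j \<longrightarrow> D $ i $ j = 0) \<and> D $ i $ i \<in> {-1, 1}}"

definition restrict_mat :: "real ^ 'n ^ 'n \<Rightarrow> 'n set \<Rightarrow> 'n set \<Rightarrow> real ^ 'n ^ 'n" where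
  "restrict_mat A J J' = (\<chi> i j. if i \<in> J \<and> j \<in> J' then A $ i $ j else 0)"

text \<open>
  The determinant of the \<open>card J \<times> card J\<close> submatrix of \<open>A\<close> indexed by \<open>J\<close>. The size
  varies with \<open>J\<close>, so the library's \<open>det\<close> does not apply directly; this is its
  defining Leibniz formula with \<open>J\<close> as the index set.
\<close>

definition principal_minor :: "real ^ 'n ^ 'n \<Rightarrow> 'n set \<Rightarrow> real" where
  "principal_minor A J =
     (\<Sum>p | p permutes J. of_int (sign p) * (\<Prod>i\<in>J. A $ i $ p i))"

lemma principal_minor_empty: "principal_minor A {} = 1"
  by (simp add: principal_minor_def)

lemma principal_minor_UNIV: "principal_minor A UNIV = det A"
  by (simp add: principal_minor_def det_def)

definition dpp_prob :: "real ^ 'n ^ 'n \<Rightarrow> 'n set \<Rightarrow> real" where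
  "dpp_prob L J = principal_minor L J / det (mat 1 + L)"

definition dpp :: "real ^ 'n ^ 'n \<Rightarrow> 'n set measure" where
  "dpp L = point_measure UNIV (\<lambda>J. ennreal (dpp_prob L J))"

definition dpp_loglik :: "(nat \<Rightarrow> 'n set) \<Rightarrow> nat \<Rightarrow> real ^ 'n ^ 'n \<Rightarrow> real" where
  "dpp_loglik z n L = 1 / real n * (\<Sum>i = 1..n. ln (dpp_prob L (z i)))"

text \<open>
  Maximizers need not be unique, and none may exist in \<open>spd\<close>; in the latter case the
  estimator takes an arbitrary value in \<open>spd\<close>.
\<close>

definition is_mle ::
    "'w measure \<Rightarrow> (nat \<Rightarrow> 'w \<Rightarrow> 'n set) \<Rightarrow> nat \<Rightarrow> ('w \<Rightarrow> real ^ 'n ^ 'n) \<Rightarrow> bool" where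
  "is_mle M Z n Lhat \<longleftrightarrow>
     Lhat \<in> borel_measurable M \<and>
     (\<forall>\<omega>\<in>space M. Lhat \<omega> \<in> spd \<and>
        ((\<exists>L. is_arg_max (dpp_loglik (\<lambda>i. Z i \<omega>) n) (\<lambda>L. L \<in> spd) L) \<longrightarrow>
         is_arg_max (dpp_loglik (\<lambda>i. Z i \<omega>) n) (\<lambda>L. L \<in> spd) (Lhat \<omega>)))"

definition block_partition :: "real ^ 'n ^ 'n \<Rightarrow> 'n set set \<Rightarrow> bool" where
  "block_partition A P \<longleftrightarrow>
     partition_on UNIV P \<and>
     (\<forall>J\<in>P. \<forall>J'\<in>P. J \<noteq> J' \<longrightarrow> (\<forall>i\<in>J. \<forall>j\<in>J'. A $ i $ j = 0))"

definition block_diagonal :: "real ^ 'n ^ 'n \<Rightarrow> bool" where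
  "block_diagonal A \<longleftrightarrow> transpose A = A \<and> (\<exists>P. block_partition A P)"

definition are_blocks :: "real ^ 'n ^ 'n \<Rightarrow> 'n set set \<Rightarrow> bool" where
  "are_blocks A P \<longleftrightarrow>
     block_partition A P \<and> (\<forall>Q. block_partition A Q \<longrightarrow> card Q \<le> card P)"

text \<open>
  \<open>X n = O\<^sub>P(r n)\<close> for sequences indexed by \<open>n \<ge> 1\<close>. Measurability is required because
  \<open>measure\<close> is \<open>0\<close> on non-measurable sets.
\<close>

definition big_O_prob :: "'w measure \<Rightarrow> (nat \<Rightarrow> 'w \<Rightarrow> real) \<Rightarrow> (nat \<Rightarrow> real) \<Rightarrow> bool" where
  "big_O_prob M X r \<longleftrightarrow>
     (\<forall>n\<ge>1. X n \<in> borel_measurable M) \<and>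
     (\<forall>\<epsilon>>0. \<exists>K. \<forall>n\<ge>1. measure M {\<omega>\<in>space M. \<bar>X n \<omega> / r n\<bar> > K} \<le> \<epsilon>)"

text \<open>So \<open>Min\<close> over the image of \<^const>\<open>sign_matrices\<close> is a true minimum.\<close>

lemma finite_sign_matrices: "finite (sign_matrices :: (real ^ 'n ^ 'n) set)"
proof -
  have "sign_matrices \<subseteq> range (\<lambda>S :: 'n set. \<chi> i j. if i = j then if i \<in> S then 1 else -1 else (0::real))"
  proof
    fix D :: "real ^ 'n ^ 'n"
    assume "D \<in> sign_matrices"
    then have "D = (\<chi> i j. if i = j then if i \<in> {i. D $ i $ i = 1} then 1 else -1 else 0)"
      unfolding sign_matrices_def vec_eq_iff by auto
    then show "D \<in> range (\<lambda>S :: 'n set. \<chi> i j. if i = j then if i \<in> S then 1 else -1 else (0::real))"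
      by blast
  qed
  then show ?thesis
    by (rule finite_subset) simp
qed

lemma sign_matrices_nonempty: "mat 1 \<in> sign_matrices"
  by (simp add: sign_matrices_def mat_def)

end

theory Submission
  imports Defs
begin

text \<open>
  The estimator maximizes the likelihood over a family of distributions that contains the true one, so
  its Kullback-Leibler divergence from the empirical distribution is at most that of the true
  distribution, which is \<open>O\<^sub>P(1/n)\<close> by concentration of the empirical frequencies. As this divergence
  dominates the squared Hellinger distance, all probabilities \<open>p\<^sub>J\<close>, hence all principal minors, are
  estimated at rate \<open>n\<^sup>-\<^sup>1\<^sup>/\<^sup>2\<close>. It remains to recover the matrix from its principal minors. Between blocks,
  the minors of size two give the square of an entry up to \<open>O\<^sub>P(n\<^sup>-\<^sup>1\<^sup>/\<^sup>2)\<close>, so the entry itself is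
  \<open>O\<^sub>P(n\<^sup>-\<^sup>1\<^sup>/\<^sup>4)\<close>. Within a block the minors determine the entries up to signs in a Lipschitz way, by
  induction along the graph of nonzero entries: adjoining an index \<open>v\<close> to \<open>K\<close> changes the minor to
  \<open>a\<^sub>v\<^sub>v det A\<^sub>K\<close> minus the derivative of the minor \<open>det A\<^sub>K\<close> in the direction \<open>a a\<^sup>T\<close>, where \<open>a\<close> is the new
  column, and this derivative, taken for all \<open>K\<close>, is injective on symmetric matrices.
\<close>

subsection \<open>Principal minors and their derivatives\<close>

lemma transpose_nth_eq: "transpose A = A \<Longrightarrow> A $ i $ j = A $ j $ i"
  by (drule arg_cong[of _ _ "\<lambda>B. B $ i $ j"]) (simp add: transpose_def)

text \<open>The product rule applied to the Leibniz sum: the directional derivative of the minor at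
  \<open>A\<close> along \<open>X\<close>, as \<open>has_real_derivative_principal_minor\<close>
  confirms. In this explicit form it is visibly linear in \<open>X\<close> and reads only entries
  indexed by \<open>K\<close>.\<close>

definition minor_deriv :: "real ^ 'n ^ 'n \<Rightarrow> real ^ 'n ^ 'n \<Rightarrow> 'n set \<Rightarrow> real" where
  "minor_deriv A X K = (\<Sum>p | p permutes K. of_int (sign p) *
     (\<Sum>i\<in>K. X $ i $ p i * (\<Prod>k\<in>K - {i}. A $ k $ p k)))"

lemma principal_minor_cong:
  assumes "\<And>i j. i \<in> K \<Longrightarrow> j \<in> K \<Longrightarrow> A $ i $ j = B $ i $ j"
  shows "principal_minor A K = principal_minor B K"
  unfolding principal_minor_def using assms
  by (intro sum.cong refl arg_cong2[where f = "(*)"] prod.cong) (auto simp: permutes_in_image)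

lemma minor_deriv_cong:
  assumes "\<And>i j. i \<in> K \<Longrightarrow> j \<in> K \<Longrightarrow> A $ i $ j = B $ i $ j"
    and "\<And>i j. i \<in> K \<Longrightarrow> j \<in> K \<Longrightarrow> X $ i $ j = Y $ i $ j"
  shows "minor_deriv A X K = minor_deriv B Y K"
  unfolding minor_deriv_def using assms
  by (intro sum.cong refl arg_cong2[where f = "(*)"] prod.cong) (auto simp: permutes_in_image)

lemma minor_deriv_add: "minor_deriv A (X + Y) K = minor_deriv A X K + minor_deriv A Y K"
  by (simp add: minor_deriv_def algebra_simps sum.distrib)

lemma minor_deriv_scaleR: "minor_deriv A (c *\<^sub>R X) K = c * minor_deriv A X K"
  unfolding minor_deriv_def sum_distrib_left
  by (intro sum.cong refl) (simp add: sum_distrib_left mult_ac)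

lemma minor_deriv_diff: "minor_deriv A (X - Y) K = minor_deriv A X K - minor_deriv A Y K"
  using minor_deriv_add[of A X "(-1) *\<^sub>R Y" K] minor_deriv_scaleR[of A "-1" Y K] by simp

lemma permutes_singleton_Collect: "{p. p permutes {v}} = {id}"
  by (auto simp: permutes_sing)

lemma principal_minor_singleton: "principal_minor A {v} = A $ v $ v"
  by (simp add: principal_minor_def permutes_singleton_Collect)

lemma minor_deriv_singleton: "minor_deriv A X {v} = X $ v $ v"
  by (simp add: minor_deriv_def permutes_singleton_Collect)

lemma has_real_derivative_principal_minor:
  "((\<lambda>t. principal_minor (A + t *\<^sub>R X) K) has_real_derivative minor_deriv A X K) (at 0)"
proof -
  have "((\<lambda>t. principal_minor (A + t *\<^sub>R X) K) has_real_derivative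
      (\<Sum>p | p permutes K. of_int (sign p) *
        (\<Sum>i\<in>K. X $ i $ p i * (\<Prod>k\<in>K - {i}. (A + 0 *\<^sub>R X) $ k $ p k)))) (at 0)"
    unfolding principal_minor_def
    by (intro DERIV_sum DERIV_cmult has_field_derivative_prod) (auto intro!: derivative_eq_intros)
  then show ?thesis by (simp add: minor_deriv_def)
qed

text \<open>Every permutation of \<open>insert v K\<close> that moves \<open>v\<close> arises from a permutation \<open>q\<close> of \<open>K\<close> by
  splicing \<open>v\<close> into an arc from \<open>i\<close> to \<open>q i\<close>, which reverses the sign.\<close>

lemma principal_minor_insert:
  fixes A :: "real ^ 'n ^ 'n"
  assumes "v \<notin> K"
  shows "principal_minor A (insert v K) =
    A $ v $ v * principal_minor A K - minor_deriv A (\<chi> i j. A $ i $ v * A $ v $ j) K"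
proof -
  let ?f = "\<lambda>p. of_int (sign p) * (\<Prod>i\<in>insert v K. A $ i $ p i) :: real"
  have [simp]: "finite K" by simp
  have fix_v: "q v = v" if "q permutes K" for q
    using assms that by (simp add: permutes_not_in)
  have main: "?f (Transposition.transpose v (q i) \<circ> q) =
      - (of_int (sign q) * (A $ i $ v * A $ v $ q i * (\<Prod>k\<in>K - {i}. A $ k $ q k)))"
    if q: "q permutes K" and i: "i \<in> K" for q i
  proof -
    have qi: "q i \<in> K" using permutes_in_image[OF q] i by simp
    have ne: "v \<noteq> q i" using assms qi by auto
    have sgn: "sign (Transposition.transpose v (q i) \<circ> q) = - sign q"
      using sign_compose[OF permutation_swap_id permutation_permutes[THEN iffD2]] q ne
      by (metis \<open>finite K\<close> mult_minus1 permutation_permutes sign_swap_id)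
    have "(\<Prod>k\<in>insert v K. A $ k $ (Transposition.transpose v (q i) \<circ> q) k)
        = A $ v $ q i * (\<Prod>k\<in>K. A $ k $ (Transposition.transpose v (q i) \<circ> q) k)"
      using assms by (simp add: fix_v[OF q])
    also have "(\<Prod>k\<in>K. A $ k $ (Transposition.transpose v (q i) \<circ> q) k)
       = A $ i $ v * (\<Prod>k\<in>K - {i}. A $ k $ (Transposition.transpose v (q i) \<circ> q) k)"
      by (subst prod.remove[OF _ i]) auto
    also have "(\<Prod>k\<in>K - {i}. A $ k $ (Transposition.transpose v (q i) \<circ> q) k) = (\<Prod>k\<in>K - {i}. A $ k $ q k)"
    proof (intro prod.cong refl)
      fix k assume k: "k \<in> K - {i}"
      have "q k \<noteq> q i" using k permutes_inj[OF q] by (auto dest: injD)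
      moreover have "q k \<noteq> v" using k assms permutes_in_image[OF q] by auto
      ultimately show "A $ k $ (Transposition.transpose v (q i) \<circ> q) k = A $ k $ q k"
        by (simp add: transpose_apply_other)
    qed
    finally show ?thesis by (simp add: sgn)
  qed
  \<comment> \<open>Each permutation of \<open>insert v K\<close> is uniquely a permutation of
    \<open>K\<close> followed by a transposition of \<open>v\<close> with some \<open>b\<close>; the
    case \<open>b = v\<close> fixes \<open>v\<close> and yields the diagonal term.\<close>
  have "principal_minor A (insert v K) =
      (\<Sum>b\<in>insert v K. \<Sum>q | q permutes K. ?f (Transposition.transpose v b \<circ> q))"
    unfolding principal_minor_def using assms by (intro sum_over_permutations_insert) auto
  also have "\<dots> = (\<Sum>q | q permutes K. ?f q) +
      (\<Sum>b\<in>K. \<Sum>q | q permutes K. ?f (Transposition.transpose v b \<circ> q))"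
    using assms by simp
  also have "(\<Sum>q | q permutes K. ?f q) = A $ v $ v * principal_minor A K"
    unfolding principal_minor_def sum_distrib_left
    using assms by (intro sum.cong refl) (simp add: fix_v)
  also have "(\<Sum>b\<in>K. \<Sum>q | q permutes K. ?f (Transposition.transpose v b \<circ> q)) =
      (\<Sum>q | q permutes K. \<Sum>b\<in>K. ?f (Transposition.transpose v b \<circ> q))"
    by (rule sum.swap)
  \<comment> \<open>Reindexing by \<open>b = q i\<close> exposes the start \<open>i\<close> of the
    arc that \<open>v\<close> is spliced into.\<close>
  also have "\<dots> = (\<Sum>q | q permutes K. \<Sum>i\<in>K. ?f (Transposition.transpose v (q i) \<circ> q))"
  proof (rule sum.cong[OF refl])
    fix q assume "q \<in> {q. q permutes K}"
    then have q: "q permutes K" by simp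
    show "(\<Sum>b\<in>K. ?f (Transposition.transpose v b \<circ> q)) = (\<Sum>i\<in>K. ?f (Transposition.transpose v (q i) \<circ> q))"
      using sum.permute[OF q, of "\<lambda>b. ?f (Transposition.transpose v b \<circ> q)"] by (simp add: comp_def)
  qed
  also have "\<dots> = - minor_deriv A (\<chi> i j. A $ i $ v * A $ v $ j) K"
    unfolding minor_deriv_def sum_negf[symmetric] sum_distrib_left
    by (intro sum.cong refl trans[OF main]) auto
  finally show ?thesis by simp
qed

lemma principal_minor_pair:
  assumes "i \<noteq> j"
  shows "principal_minor A {i, j} = A $ i $ i * A $ j $ j - A $ i $ j * A $ j $ i"
  using principal_minor_insert[of i "{j}" A] assms
  by (simp add: principal_minor_singleton minor_deriv_singleton)

text \<open>\<open>principal_minor_insert\<close> is differentiated along \<open>X\<close>. As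
  \<open>X\<close> vanishes on \<open>K\<close>, both the minor over \<open>K\<close> and the base
  point of the inner derivative stay fixed; only the diagonal entry and the border vary.\<close>

lemma minor_deriv_insert:
  fixes A X :: "real ^ 'n ^ 'n"
  assumes v: "v \<notin> K" and X0: "\<And>i j. i \<in> K \<Longrightarrow> j \<in> K \<Longrightarrow> X $ i $ j = 0"
  shows "minor_deriv A X (insert v K) = X $ v $ v * principal_minor A K
    - minor_deriv A (\<chi> i j. X $ i $ v * A $ v $ j + A $ i $ v * X $ v $ j) K"
proof -
  let ?Y0 = "\<chi> i j. A $ i $ v * A $ v $ j"
  let ?Y1 = "\<chi> i j. X $ i $ v * A $ v $ j + A $ i $ v * X $ v $ j"
  let ?Y2 = "\<chi> i j. X $ i $ v * X $ v $ j"
  \<comment> \<open>The border product is quadratic in \<open>t\<close>, and \<open>?Y1\<close> is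
    its linear coefficient.\<close>
  have "principal_minor (A + t *\<^sub>R X) (insert v K) =
      (A $ v $ v + t * X $ v $ v) * principal_minor A K
      - (minor_deriv A ?Y0 K + t * minor_deriv A ?Y1 K + t^2 * minor_deriv A ?Y2 K)" for t
  proof -
    have "principal_minor (A + t *\<^sub>R X) K = principal_minor A K"
      by (rule principal_minor_cong) (simp add: X0)
    moreover have "minor_deriv (A + t *\<^sub>R X)
        (\<chi> i j. (A + t *\<^sub>R X) $ i $ v * (A + t *\<^sub>R X) $ v $ j) K
      = minor_deriv A (?Y0 + t *\<^sub>R ?Y1 + t^2 *\<^sub>R ?Y2) K"
      by (rule minor_deriv_cong) (simp_all add: X0 algebra_simps power2_eq_square)
    ultimately show ?thesis
      unfolding principal_minor_insert[OF v] by (simp add: minor_deriv_add minor_deriv_scaleR)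
  qed
  then have "((\<lambda>t. (A $ v $ v + t * X $ v $ v) * principal_minor A K
      - (minor_deriv A ?Y0 K + t * minor_deriv A ?Y1 K + t^2 * minor_deriv A ?Y2 K))
      has_real_derivative minor_deriv A X (insert v K)) (at 0)"
    using has_real_derivative_principal_minor[of A X "insert v K"] by simp
  moreover have "((\<lambda>t. (A $ v $ v + t * X $ v $ v) * principal_minor A K
      - (minor_deriv A ?Y0 K + t * minor_deriv A ?Y1 K + t^2 * minor_deriv A ?Y2 K))
      has_real_derivative X $ v $ v * principal_minor A K - minor_deriv A ?Y1 K) (at 0)"
    by (auto intro!: derivative_eq_intros)
  ultimately show ?thesis by (rule DERIV_unique)
qed

text \<open>In each Leibniz term every index of \<open>K\<close> occurs once as a row and once as a
  column, so its sign is squared. Hence minors can determine a matrix only up to conjugation by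
  signs.\<close>

lemma principal_minor_signs:
  fixes A :: "real ^ 'n ^ 'n" and s :: "'n \<Rightarrow> real"
  assumes "\<And>i. s i = 1 \<or> s i = -1"
  shows "principal_minor (\<chi> i j. s i * s j * A $ i $ j) K = principal_minor A K"
  unfolding principal_minor_def
proof (intro sum.cong refl arg_cong2[where f = "(*)"])
  fix p assume "p \<in> {p. p permutes K}"
  then have p: "p permutes K" by simp
  have "(\<Prod>i\<in>K. (\<chi> i j. s i * s j * A $ i $ j) $ i $ p i)
    = prod s K * prod (s \<circ> p) K * (\<Prod>i\<in>K. A $ i $ p i)"
    by (simp add: prod.distrib)
  also have "prod (s \<circ> p) K = prod s K" using prod.permute[OF p, of s] by simp
  also have "prod s K * prod s K = 1"
    unfolding prod.distrib[symmetric] by (rule prod.neutral) (metis assms mult_1 mult_minus_left minus_minus)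
  finally show "(\<Prod>i\<in>K. (\<chi> i j. s i * s j * A $ i $ j) $ i $ p i) = (\<Prod>i\<in>K. A $ i $ p i)" by simp
qed

text \<open>Telescoping: factors are exchanged one at a time. The exponent \<open>card I\<close> is
  one larger than the count of remaining factors, which is harmless for \<open>R \<ge> 1\<close> and
  avoids a subtraction.\<close>

lemma abs_prod_diff_le:
  fixes f g :: "'a \<Rightarrow> real"
  assumes "finite I" "R \<ge> 1" "e \<ge> 0"
    and "\<And>i. i \<in> I \<Longrightarrow> \<bar>f i\<bar> \<le> R" "\<And>i. i \<in> I \<Longrightarrow> \<bar>g i\<bar> \<le> R" "\<And>i. i \<in> I \<Longrightarrow> \<bar>f i - g i\<bar> \<le> e"
  shows "\<bar>prod f I - prod g I\<bar> \<le> real (card I) * R ^ card I * e"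
  using assms(1,4-)
proof (induction I rule: finite_induct)
  case (insert x I)
  have "\<bar>prod g I\<bar> \<le> R ^ card I"
    unfolding abs_prod using insert.prems by (intro prod_le_power) (auto simp: \<open>R \<ge> 1\<close>)
  then have 1: "\<bar>f x - g x\<bar> * \<bar>prod g I\<bar> \<le> e * R ^ card I"
    using insert.prems \<open>e \<ge> 0\<close> by (intro mult_mono) auto
  have 2: "\<bar>f x\<bar> * \<bar>prod f I - prod g I\<bar> \<le> R * (real (card I) * R ^ card I * e)"
    using insert \<open>R \<ge> 1\<close> by (intro mult_mono) auto
  have 3: "e * R ^ card I \<le> R * (e * R ^ card I)"
    using \<open>R \<ge> 1\<close> \<open>e \<ge> 0\<close> mult_right_mono[of 1 R "e * R ^ card I"] by simp
  have "prod f (insert x I) - prod g (insert x I) =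
     f x * (prod f I - prod g I) + (f x - g x) * prod g I"
    using insert.hyps by (simp add: algebra_simps)
  then have "\<bar>prod f (insert x I) - prod g (insert x I)\<bar> \<le>
    \<bar>f x\<bar> * \<bar>prod f I - prod g I\<bar> + \<bar>f x - g x\<bar> * \<bar>prod g I\<bar>"
    by (metis abs_mult abs_triangle_ineq)
  then show ?case using 1 2 3 insert.hyps by (simp add: algebra_simps)
qed simp

text \<open>Lipschitz dependence on the base point with the direction held fixed. The constant
  counts permutations and summands with \<open>CARD('n)\<close> in place of \<open>card K\<close>,
  so that it is uniform in \<open>K\<close>.\<close>

lemma minor_deriv_lipschitz:
  fixes A B Y :: "real ^ 'n ^ 'n" and R e :: real
  assumes R: "R \<ge> 1" and e: "e \<ge> 0"
    and A: "\<And>i j. i \<in> K \<Longrightarrow> j \<in> K \<Longrightarrow> \<bar>A $ i $ j\<bar> \<le> R"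
    and B: "\<And>i j. i \<in> K \<Longrightarrow> j \<in> K \<Longrightarrow> \<bar>B $ i $ j\<bar> \<le> R"
    and AB: "\<And>i j. i \<in> K \<Longrightarrow> j \<in> K \<Longrightarrow> \<bar>A $ i $ j - B $ i $ j\<bar> \<le> e"
    and Y: "\<And>i j. i \<in> K \<Longrightarrow> j \<in> K \<Longrightarrow> \<bar>Y $ i $ j\<bar> \<le> R"
  shows "\<bar>minor_deriv A Y K - minor_deriv B Y K\<bar> \<le>
    fact CARD('n) * (CARD('n) * (R * (CARD('n) * R ^ CARD('n) * e)))"
proof -
  let ?N = "CARD('n)"
  have cardK: "card S \<le> ?N" for S :: "'n set" by (simp add: card_mono)
  have t: "\<bar>Y $ i $ p i * ((\<Prod>k\<in>K - {i}. A $ k $ p k) - (\<Prod>k\<in>K - {i}. B $ k $ p k))\<bar>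
      \<le> R * (?N * R ^ ?N * e)" if p: "p permutes K" and i: "i \<in> K" for p i
    unfolding abs_mult
  proof (intro mult_mono)
    have "\<bar>(\<Prod>k\<in>K - {i}. A $ k $ p k) - (\<Prod>k\<in>K - {i}. B $ k $ p k)\<bar>
        \<le> real (card (K - {i})) * R ^ card (K - {i}) * e"
      using A B AB R e p by (intro abs_prod_diff_le) (auto simp: permutes_in_image)
    also have "\<dots> \<le> ?N * R ^ ?N * e"
      using e R cardK by (intro mult_mono power_increasing) auto
    finally show "\<bar>(\<Prod>k\<in>K - {i}. A $ k $ p k) - (\<Prod>k\<in>K - {i}. B $ k $ p k)\<bar> \<le> ?N * R ^ ?N * e" .
  qed (use Y p i R e in \<open>auto simp: permutes_in_image\<close>)
  have s: "\<bar>\<Sum>i\<in>K. Y $ i $ p i * ((\<Prod>k\<in>K - {i}. A $ k $ p k) - (\<Prod>k\<in>K - {i}. B $ k $ p k))\<bar>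
      \<le> ?N * (R * (?N * R ^ ?N * e))" if p: "p permutes K" for p
  proof -
    have "\<bar>\<Sum>i\<in>K. Y $ i $ p i * ((\<Prod>k\<in>K - {i}. A $ k $ p k) - (\<Prod>k\<in>K - {i}. B $ k $ p k))\<bar>
      \<le> (\<Sum>i\<in>K. R * (?N * R ^ ?N * e))"
      using t[OF p] by (intro order_trans[OF sum_abs] sum_mono) auto
    also have "\<dots> \<le> ?N * (R * (?N * R ^ ?N * e))"
      using cardK[of K] R e by (simp add: mult_right_mono)
    finally show ?thesis .
  qed
  have "minor_deriv A Y K - minor_deriv B Y K = (\<Sum>p | p permutes K. of_int (sign p) *
      (\<Sum>i\<in>K. Y $ i $ p i * ((\<Prod>k\<in>K - {i}. A $ k $ p k) - (\<Prod>k\<in>K - {i}. B $ k $ p k))))"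
    by (simp add: minor_deriv_def sum_subtractf[symmetric] right_diff_distrib[symmetric])
  also have "\<bar>\<dots>\<bar> \<le> (\<Sum>p | p permutes K. ?N * (R * (?N * R ^ ?N * e)))"
    using s by (intro order_trans[OF sum_abs] sum_mono) (auto simp: abs_mult sign_def)
  also have "\<dots> = fact (card K) * (?N * (R * (?N * R ^ ?N * e)))"
    using card_permutations[of K "card K"] by simp
  also have "\<dots> \<le> fact ?N * (?N * (R * (?N * R ^ ?N * e)))"
    using cardK[of K] R e by (intro mult_right_mono fact_mono) auto
  finally show ?thesis .
qed

text \<open>The derivative is a linear functional of the direction; summing the absolute values of
  its coefficients over all index sets gives one constant for every \<open>K\<close>.\<close>

lemma minor_deriv_bounded:
  fixes A :: "real ^ 'n ^ 'n"
  shows "\<exists>M\<ge>0. \<forall>Y K e. (\<forall>i\<in>K. \<forall>j\<in>K. \<bar>Y $ i $ j\<bar> \<le> e) \<longrightarrow> e \<ge> 0 \<longrightarrow> \<bar>minor_deriv A Y K\<bar> \<le> M * e"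
proof (intro exI conjI allI impI)
  let ?M = "\<Sum>K\<in>UNIV. \<Sum>p | p permutes K. \<Sum>i\<in>K. \<bar>\<Prod>k\<in>K - {i}. A $ k $ p k\<bar>"
  show "?M \<ge> 0" by (intro sum_nonneg) auto
  fix Y :: "real ^ 'n ^ 'n" and K :: "'n set" and e :: real
  assume Y: "\<forall>i\<in>K. \<forall>j\<in>K. \<bar>Y $ i $ j\<bar> \<le> e" and e: "e \<ge> 0"
  have "\<bar>minor_deriv A Y K\<bar> \<le> (\<Sum>p | p permutes K. \<Sum>i\<in>K. e * \<bar>\<Prod>k\<in>K - {i}. A $ k $ p k\<bar>)"
    unfolding minor_deriv_def
  proof (intro order_trans[OF sum_abs] sum_mono)
    fix p assume "p \<in> {p. p permutes K}"
    then have p: "p permutes K" by simp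
    have "\<bar>\<Sum>i\<in>K. Y $ i $ p i * (\<Prod>k\<in>K - {i}. A $ k $ p k)\<bar> \<le> (\<Sum>i\<in>K. e * \<bar>\<Prod>k\<in>K - {i}. A $ k $ p k\<bar>)"
      using Y p by (intro order_trans[OF sum_abs] sum_mono)
        (auto simp: abs_mult permutes_in_image intro!: mult_right_mono)
    then show "\<bar>of_int (sign p) * (\<Sum>i\<in>K. Y $ i $ p i * (\<Prod>k\<in>K - {i}. A $ k $ p k))\<bar>
        \<le> (\<Sum>i\<in>K. e * \<bar>\<Prod>k\<in>K - {i}. A $ k $ p k\<bar>)"
      by (simp add: abs_mult sign_def)
  qed
  also have "\<dots> = e * (\<Sum>p | p permutes K. \<Sum>i\<in>K. \<bar>\<Prod>k\<in>K - {i}. A $ k $ p k\<bar>)"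
    by (simp add: sum_distrib_left)
  also have "\<dots> \<le> e * ?M"
    using e by (intro mult_left_mono member_le_sum sum_nonneg) auto
  finally show "\<bar>minor_deriv A Y K\<bar> \<le> ?M * e" by (simp add: mult.commute)
qed

subsection \<open>Recovering a block from its principal minors\<close>

text \<open>Connectedness of a set of indices in the graph of nonzero entries of \<open>A\<close>, in a form suited to
  induction.\<close>

inductive grown :: "real ^ 'n ^ 'n \<Rightarrow> 'n set \<Rightarrow> bool" for A where
  single: "grown A {v}"
| insert: "grown A S \<Longrightarrow> v \<notin> S \<Longrightarrow> u \<in> S \<Longrightarrow> A $ u $ v \<noteq> 0 \<Longrightarrow> grown A (insert v S)"

text \<open>This is the nonsingularity of the Fisher information on a block. Let \<open>a\<close> and \<open>x\<close> be the new columns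
  of \<open>A\<close> and \<open>X\<close>. The induction step applies the hypothesis to the symmetric matrix with entries
  \<open>x i * a j + a i * x j\<close>, which controls \<open>x\<close> because \<open>a\<close> does not vanish on \<open>S\<close>.\<close>

lemma minor_deriv_bounded_below:
  fixes A :: "real ^ 'n ^ 'n"
  assumes "grown A S" and sym: "transpose A = A"
  shows "\<exists>C\<ge>0. \<forall>X d. transpose X = X \<longrightarrow> d \<ge> 0 \<longrightarrow> (\<forall>K\<subseteq>S. \<bar>minor_deriv A X K\<bar> \<le> d) \<longrightarrow>
    (\<forall>i\<in>S. \<forall>j\<in>S. \<bar>X $ i $ j\<bar> \<le> C * d)"
  using assms(1)
proof induction
  case (single v)
  show ?case
  proof (intro exI[of _ 1] conjI allI impI ballI)
    fix X d i j
    assume "\<forall>K\<subseteq>{v}. \<bar>minor_deriv A X K\<bar> \<le> d" "i \<in> {v}" "j \<in> {v}"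
    then show "\<bar>X $ i $ j\<bar> \<le> 1 * d"
      by (auto simp: minor_deriv_singleton dest: spec[of _ "{v}"])
  qed simp
next
  case (insert S v u)
  obtain C where C: "C \<ge> 0" and IH: "\<And>X d i j. transpose X = X \<Longrightarrow> d \<ge> 0 \<Longrightarrow>
      (\<And>K. K \<subseteq> S \<Longrightarrow> \<bar>minor_deriv A X K\<bar> \<le> d) \<Longrightarrow> i \<in> S \<Longrightarrow> j \<in> S \<Longrightarrow> \<bar>X $ i $ j\<bar> \<le> C * d"
    using insert.IH by blast
  obtain M where M: "M \<ge> 0" and M': "\<And>Y K e. (\<forall>i\<in>K. \<forall>j\<in>K. \<bar>Y $ i $ j\<bar> \<le> e) \<Longrightarrow> e \<ge> 0 \<Longrightarrow>
      \<bar>minor_deriv A Y K\<bar> \<le> M * e"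
    using minor_deriv_bounded by metis
  define m where "m = (\<Sum>K\<in>UNIV. \<bar>principal_minor A K\<bar>)"
  have m: "\<bar>principal_minor A K\<bar> \<le> m" for K unfolding m_def by (rule member_le_sum) auto
  have m0: "m \<ge> 0" using m[of "{}"] by linarith
  define a where "a i = A $ i $ v" for i
  define a0 where "a0 = \<bar>a u\<bar>"
  have a0: "a0 > 0" using insert.hyps by (simp add: a0_def a_def)
  define am where "am = (\<Sum>i\<in>UNIV. \<bar>a i\<bar>)"
  have am: "\<bar>a i\<bar> \<le> am" for i unfolding am_def by (rule member_le_sum) auto
  have am0: "am \<ge> 0" using am[of undefined] by linarith
  \<comment> \<open>Times \<open>d\<close>, the constants \<open>C1\<close>, \<open>C2\<close> and
    \<open>C3\<close> will bound the matrix \<open>Y\<close> on \<open>S\<close>, the entry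
    \<open>x u\<close>, and the whole column \<open>x\<close> on \<open>S\<close>. The divisions by
    \<open>a0\<close> are where the edge from \<open>u\<close> to \<open>v\<close> is used.\<close>
  define C1 where "C1 = C * (m + 1 + M * C)"
  have C1: "C1 \<ge> 0" unfolding C1_def using C M m0 by simp
  define C2 where "C2 = C1 / a0"
  have C2: "C2 \<ge> 0" unfolding C2_def using C1 a0 by simp
  define C3 where "C3 = (C1 + am * C2) / a0"
  have C3: "C3 \<ge> 0" unfolding C3_def using C1 C2 am0 a0 by simp
  show ?case
  \<comment> \<open>The summands serve the entry at \<open>v\<close>, the entries in
    \<open>S\<close> and the new column, respectively.\<close>
  proof (intro exI[of _ "1 + C + C3"] conjI allI impI ballI)
    show "1 + C + C3 \<ge> 0" using C C3 by simp
    fix X :: "real ^ 'n ^ 'n" and d i j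
    assume sX: "transpose X = X" and d: "d \<ge> 0"
      and H: "\<forall>K\<subseteq>insert v S. \<bar>minor_deriv A X K\<bar> \<le> d"
      and i: "i \<in> insert v S" and j: "j \<in> insert v S"
    have symX: "X $ i $ j = X $ j $ i" for i j using transpose_nth_eq[OF sX] .
    have XS: "\<bar>X $ i $ j\<bar> \<le> C * d" if "i \<in> S" "j \<in> S" for i j
      using IH[OF sX d _ that] H by blast
    have Xvv: "\<bar>X $ v $ v\<bar> \<le> d"
      using H[rule_format, of "{v}"] by (simp add: minor_deriv_singleton)
    define x where "x i = X $ i $ v" for i
    define Y where "Y = (\<chi> i j. X $ i $ v * A $ v $ j + A $ i $ v * X $ v $ j)"
    have Yij: "Y $ i $ j = x i * a j + a i * x j" for i j
      unfolding Y_def x_def a_def using symX transpose_nth_eq[OF sym, of v j] by simp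
    have sY: "transpose Y = Y"
      by (simp add: vec_eq_iff transpose_def Yij)
    have bY: "\<bar>minor_deriv A Y K\<bar> \<le> (m + 1 + M * C) * d" if K: "K \<subseteq> S" for K
    proof -
      \<comment> \<open>\<open>X1\<close> is the part of \<open>X\<close> already bounded by
        induction. The rest vanishes on \<open>S\<close>, so \<open>minor_deriv_insert\<close>
        applies to it and produces \<open>minor_deriv A Y K\<close>.\<close>
      define X1 where "X1 = (\<chi> i j. if i \<in> S \<and> j \<in> S then X $ i $ j else 0)"
      have vK: "v \<notin> K" using K insert.hyps by auto
      have "minor_deriv A (X - X1) (insert v K) = (X - X1) $ v $ v * principal_minor A K
          - minor_deriv A (\<chi> i j. (X - X1) $ i $ v * A $ v $ j + A $ i $ v * (X - X1) $ v $ j) K"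
        using K by (intro minor_deriv_insert[OF vK]) (auto simp: X1_def)
      moreover have "(X - X1) $ v $ v = X $ v $ v" using insert.hyps by (simp add: X1_def)
      moreover have "minor_deriv A (\<chi> i j. (X - X1) $ i $ v * A $ v $ j + A $ i $ v * (X - X1) $ v $ j) K
          = minor_deriv A Y K"
        using insert.hyps by (intro minor_deriv_cong) (auto simp: X1_def Y_def)
      ultimately have "minor_deriv A Y K = X $ v $ v * principal_minor A K
          - minor_deriv A X (insert v K) + minor_deriv A X1 (insert v K)"
        by (simp add: minor_deriv_diff)
      moreover have "\<bar>X $ v $ v * principal_minor A K\<bar> \<le> d * m"
        unfolding abs_mult using Xvv m d by (intro mult_mono) auto
      moreover have "\<bar>minor_deriv A X (insert v K)\<bar> \<le> d" using H K by blast
      moreover have "\<bar>minor_deriv A X1 (insert v K)\<bar> \<le> M * (C * d)"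
        using XS C d by (intro M') (auto simp: X1_def)
      ultimately show ?thesis by (simp add: algebra_simps)
    qed
    have Yb: "\<bar>x i * a j + a i * x j\<bar> \<le> C1 * d" if "i \<in> S" "j \<in> S" for i j
      using IH[OF sY _ bY that] d M C m0 unfolding Yij C1_def by (simp add: mult.assoc)
    \<comment> \<open>The entry of \<open>Y\<close> at \<open>u\<close>, \<open>u\<close> is
      \<open>2 * x u * a u\<close> and isolates \<open>x u\<close>; row \<open>u\<close> then gives
      the remaining \<open>x j\<close>.\<close>
    have "2 * \<bar>x u\<bar> * a0 \<le> C1 * d"
      using Yb[OF insert.hyps(3) insert.hyps(3)] by (simp add: a0_def abs_mult mult.commute)
    moreover have "0 \<le> \<bar>x u\<bar> * a0" using a0 by simp
    ultimately have "\<bar>x u\<bar> * a0 \<le> C1 * d" by linarith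
    then have xu: "\<bar>x u\<bar> \<le> C2 * d"
      using a0 by (simp add: C2_def field_simps)
    have xj: "\<bar>x j\<bar> \<le> C3 * d" if "j \<in> S" for j
    proof -
      have "\<bar>x u * a j\<bar> \<le> C2 * d * am"
        unfolding abs_mult using xu am am0 C2 d by (intro mult_mono) auto
      moreover have "\<bar>a u * x j\<bar> = a0 * \<bar>x j\<bar>" by (simp add: a0_def abs_mult)
      moreover note Yb[OF insert.hyps(3) that]
      ultimately have "a0 * \<bar>x j\<bar> \<le> C1 * d + C2 * d * am" by linarith
      then show ?thesis using a0 by (simp add: C3_def field_simps)
    qed
    have ge: "d \<le> (1 + C + C3) * d" "C * d \<le> (1 + C + C3) * d" "C3 * d \<le> (1 + C + C3) * d"
      using C C3 d by (simp_all add: algebra_simps add_nonneg_nonneg)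
    show "\<bar>X $ i $ j\<bar> \<le> (1 + C + C3) * d"
    proof (cases "i = v"; cases "j = v")
      assume "i = v" "j = v" then show ?thesis using Xvv ge by simp
    next
      assume "i = v" "j \<noteq> v"
      then show ?thesis using xj[of j] ge j symX[of v j] by (auto simp: x_def)
    next
      assume "i \<noteq> v" "j = v"
      then show ?thesis using xj[of i] ge i by (auto simp: x_def)
    next
      assume "i \<noteq> v" "j \<noteq> v"
      then show ?thesis using XS[of i j] ge i j by auto
    qed
  qed
qed

text \<open>Once signs are adjusted so that \<open>B\<close> is close to \<open>A\<close> on \<open>S\<close>, bordering shows that the new columns
  \<open>b\<close> and \<open>a\<close> have \<open>minor_deriv A\<close> of the matrix with entries \<open>b i * b j - a i * a j\<close> small for all minors
  in \<open>S\<close>; hence this matrix is small, and \<open>b\<close> is close to \<open>a\<close> or to \<open>- a\<close>.\<close>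

lemma minors_determine_entries:
  fixes A :: "real ^ 'n ^ 'n"
  assumes "grown A S" and sym: "transpose A = A"
  shows "\<exists>C\<ge>0. \<forall>B d. transpose B = B \<longrightarrow> 0 \<le> d \<longrightarrow> d \<le> 1 \<longrightarrow>
    (\<forall>K\<subseteq>S. \<bar>principal_minor B K - principal_minor A K\<bar> \<le> d) \<longrightarrow>
    (\<exists>s. (\<forall>i. s i = 1 \<or> s i = -1) \<and> (\<forall>i\<in>S. \<forall>j\<in>S. \<bar>s i * s j * B $ i $ j - A $ i $ j\<bar> \<le> C * d))"
  using assms(1)
proof induction
  case (single v)
  show ?case
  proof (intro exI[of _ 1] conjI allI impI ballI)
    fix B d
    assume "\<forall>K\<subseteq>{v}. \<bar>principal_minor B K - principal_minor A K\<bar> \<le> d"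
    then have "\<bar>B $ v $ v - A $ v $ v\<bar> \<le> d"
      by (auto simp: principal_minor_singleton dest: spec[of _ "{v}"])
    then show "\<exists>s. (\<forall>i. s i = 1 \<or> s i = -1) \<and>
        (\<forall>i\<in>{v}. \<forall>j\<in>{v}. \<bar>s i * s j * B $ i $ j - A $ i $ j\<bar> \<le> 1 * d)"
      by (intro exI[of _ "\<lambda>_. 1"]) simp
  qed simp
next
  case (insert S v u)
  obtain C where C: "C \<ge> 0" and IH: "\<And>B d. transpose B = B \<Longrightarrow> 0 \<le> d \<Longrightarrow> d \<le> 1 \<Longrightarrow>
      (\<And>K. K \<subseteq> S \<Longrightarrow> \<bar>principal_minor B K - principal_minor A K\<bar> \<le> d) \<Longrightarrow>
      \<exists>s. (\<forall>i. s i = 1 \<or> s i = -1) \<and> (\<forall>i\<in>S. \<forall>j\<in>S. \<bar>s i * s j * B $ i $ j - A $ i $ j\<bar> \<le> C * d)"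
    using insert.IH by blast
  obtain Q where Q: "Q \<ge> 0" and Q': "\<And>X d i j. transpose X = X \<Longrightarrow> d \<ge> 0 \<Longrightarrow>
      (\<And>K. K \<subseteq> S \<Longrightarrow> \<bar>minor_deriv A X K\<bar> \<le> d) \<Longrightarrow> i \<in> S \<Longrightarrow> j \<in> S \<Longrightarrow> \<bar>X $ i $ j\<bar> \<le> Q * d"
    using minor_deriv_bounded_below[OF insert.hyps(1) sym] by blast
  define m where "m = (\<Sum>K\<in>UNIV. \<bar>principal_minor A K\<bar>)"
  have m: "\<bar>principal_minor A K\<bar> \<le> m" for K unfolding m_def by (rule member_le_sum) auto
  have m0: "m \<ge> 0" using m[of "{}"] by linarith
  \<comment> \<open>\<open>R0\<close> is to bound the entries of \<open>A\<close>, those of the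
    sign-adjusted \<open>B\<close> on \<open>S\<close>, and the new column of \<open>B\<close>;
    \<open>R\<close> bounds in addition the products of two column entries.\<close>
  define R0 where "R0 = 1 + (\<Sum>i\<in>UNIV. \<Sum>j\<in>UNIV. \<bar>A $ i $ j\<bar>) + C + (m + 1)"
  have A0: "\<bar>A $ i $ j\<bar> \<le> (\<Sum>i\<in>UNIV. \<Sum>j\<in>UNIV. \<bar>A $ i $ j\<bar>)" for i j
  proof -
    have "\<bar>A $ i $ j\<bar> \<le> (\<Sum>j\<in>UNIV. \<bar>A $ i $ j\<bar>)" by (rule member_le_sum) auto
    also have "\<dots> \<le> (\<Sum>i\<in>UNIV. \<Sum>j\<in>UNIV. \<bar>A $ i $ j\<bar>)" by (rule member_le_sum) (auto intro: sum_nonneg)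
    finally show ?thesis .
  qed
  have sA0: "(\<Sum>i\<in>UNIV. \<Sum>j\<in>UNIV. \<bar>A $ i $ j\<bar>) \<ge> 0" by (intro sum_nonneg) auto
  have R01: "R0 \<ge> 1" unfolding R0_def using sA0 C m0 by simp
  define R where "R = R0 * R0 + R0"
  have R0R: "R0 \<le> R" unfolding R_def by simp
  have RR: "R0 * R0 \<le> R" unfolding R_def using R01 by simp
  have R1: "R \<ge> 1" using R01 R0R by simp
  \<comment> \<open>The Lipschitz constant of \<open>minor_deriv_lipschitz\<close> at
    \<open>R\<close>. Below, \<open>C1\<close>, \<open>C2\<close> and \<open>C3\<close> times
    \<open>d\<close> bound the matrix \<open>X\<close>, the error of the new column at
    \<open>u\<close>, and its error on all of \<open>S\<close>.\<close>
  define L where "L = fact CARD('n) * (CARD('n) * (R * (CARD('n) * R ^ CARD('n))))"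
  have L0: "L \<ge> 0" unfolding L_def using R1 by simp
  define C1 where "C1 = Q * (L * C + (m + 1) + R0 + 1)"
  have C1: "C1 \<ge> 0" unfolding C1_def using Q L0 C m0 R01 by simp
  define a where "a i = A $ i $ v" for i
  define a0 where "a0 = \<bar>a u\<bar>"
  have a0: "a0 > 0" using insert.hyps by (simp add: a0_def a_def)
  define C2 where "C2 = C1 / a0"
  have C2: "C2 \<ge> 0" unfolding C2_def using C1 a0 by simp
  define C3 where "C3 = (R0 * C2 + C1) / a0"
  have C3: "C3 \<ge> 0" unfolding C3_def using C1 C2 R01 a0 by simp
  show ?case
  proof (intro exI[of _ "1 + C + C3"] conjI allI impI)
    show "1 + C + C3 \<ge> 0" using C C3 by simp
    fix B :: "real ^ 'n ^ 'n" and d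
    assume sB: "transpose B = B" and d: "0 \<le> d" and d1: "d \<le> 1"
      and H: "\<forall>K\<subseteq>insert v S. \<bar>principal_minor B K - principal_minor A K\<bar> \<le> d"
    obtain s where s: "\<And>i. s i = 1 \<or> s i = -1"
      and sS: "\<And>i j. i \<in> S \<Longrightarrow> j \<in> S \<Longrightarrow> \<bar>s i * s j * B $ i $ j - A $ i $ j\<bar> \<le> C * d"
      using IH[OF sB d d1] H by blast
    define B' where "B' = (\<chi> i j. s i * s j * B $ i $ j)"
    have B'ij: "B' $ i $ j = s i * s j * B $ i $ j" for i j by (simp add: B'_def)
    have mB': "principal_minor B' K = principal_minor B K" for K
      unfolding B'_def by (rule principal_minor_signs[OF s])
    have symB': "B' $ i $ j = B' $ j $ i" for i j
      unfolding B'ij using transpose_nth_eq[OF sB, of i j] by simp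
    define b where "b i = B' $ i $ v" for i
    have mB: "\<bar>principal_minor B K\<bar> \<le> m + 1" if "K \<subseteq> insert v S" for K
      using H[rule_format, OF that] m[of K] d1 by linarith
    have bvv: "\<bar>B' $ v $ v - A $ v $ v\<bar> \<le> d"
      using H[rule_format, of "{v}"] mB'[of "{v}"] by (simp add: principal_minor_singleton)
    have diag: "\<bar>B' $ i $ i\<bar> \<le> m + 1" if "i \<in> insert v S" for i
      using mB[of "{i}"] mB'[of "{i}"] that by (simp add: principal_minor_singleton)
    have bS: "\<bar>B' $ i $ j\<bar> \<le> R0" if "i \<in> S" "j \<in> S" for i j
    proof -
      have "C * d \<le> C" using C d1 by (simp add: mult_left_le)
      then show ?thesis using sS[OF that] A0[of i j] m0 unfolding B'ij R0_def by linarith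
    qed
    \<comment> \<open>Nothing yet relates the column \<open>b\<close> to that of \<open>A\<close>,
      but the minor over \<open>{i, v}\<close> bounds its squares.\<close>
    have bb: "\<bar>b i\<bar> \<le> R0" if "i \<in> S" for i
    proof -
      have "i \<noteq> v" using that insert.hyps by auto
      then have "(b i)\<^sup>2 = B' $ i $ i * B' $ v $ v - principal_minor B' {i, v}"
        using symB'[of v i] by (simp add: principal_minor_pair b_def power2_eq_square)
      also have "\<dots> \<le> \<bar>B' $ i $ i\<bar> * \<bar>B' $ v $ v\<bar> + \<bar>principal_minor B' {i, v}\<bar>"
        using abs_mult[of "B' $ i $ i" "B' $ v $ v"] by linarith
      also have "\<dots> \<le> (m + 1) * (m + 1) + (m + 1)"
        using diag[of i] diag[of v] mB[of "{i,v}"] mB'[of "{i,v}"] that m0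
        by (intro add_mono mult_mono) auto
      also have "\<dots> \<le> (m + 2)\<^sup>2" using m0 by (simp add: power2_eq_square algebra_simps)
      finally have "\<bar>b i\<bar> \<le> m + 2" using m0 by (simp add: abs_le_square_iff[symmetric])
      then show ?thesis unfolding R0_def using sA0 C by linarith
    qed
    define X where "X = (\<chi> i j. b i * b j - a i * a j)"
    have sX: "transpose X = X" by (simp add: X_def transpose_def vec_eq_iff mult.commute)
    \<comment> \<open>The bordering formulas for \<open>B'\<close> and \<open>A\<close> are
      subtracted. Fact 3 pays for moving the base point from \<open>B'\<close> to \<open>A\<close>;
      facts 4 to 6 use the closeness of minors over \<open>{v}\<close>, \<open>K\<close> and
      \<open>insert v K\<close>.\<close>
    have XK: "\<bar>minor_deriv A X K\<bar> \<le> (L * C + (m + 1) + R0 + 1) * d" if K: "K \<subseteq> S" for K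
    proof -
      define Y where "Y = (\<chi> i j. B' $ i $ v * B' $ v $ j)"
      define W where "W = (\<chi> i j. A $ i $ v * A $ v $ j)"
      have XYW: "X = Y - W"
        by (simp add: X_def Y_def W_def vec_eq_iff b_def a_def symB'[of v] transpose_nth_eq[OF sym, of v])
      have vK: "v \<notin> K" using K insert.hyps by auto
      have 1: "principal_minor B' (insert v K) = B' $ v $ v * principal_minor B' K - minor_deriv B' Y K"
        unfolding Y_def by (rule principal_minor_insert[OF vK])
      have 2: "principal_minor A (insert v K) = A $ v $ v * principal_minor A K - minor_deriv A W K"
        unfolding W_def by (rule principal_minor_insert[OF vK])
      have 3: "\<bar>minor_deriv A Y K - minor_deriv B' Y K\<bar> \<le> L * (C * d)"
      proof -
        have "\<bar>minor_deriv A Y K - minor_deriv B' Y K\<bar> \<le>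
            fact CARD('n) * (CARD('n) * (R * (CARD('n) * R ^ CARD('n) * (C * d))))"
        proof (rule minor_deriv_lipschitz[OF R1])
          fix i j assume ij: "i \<in> K" "j \<in> K"
          then have ij': "i \<in> S" "j \<in> S" using K by auto
          show "\<bar>A $ i $ j\<bar> \<le> R" using A0[of i j] R0R C m0 unfolding R0_def by linarith
          show "\<bar>B' $ i $ j\<bar> \<le> R" using bS[OF ij'] R0R by linarith
          show "\<bar>A $ i $ j - B' $ i $ j\<bar> \<le> C * d" using sS[OF ij'] unfolding B'ij by linarith
          have "\<bar>b i * b j\<bar> \<le> R0 * R0"
            unfolding abs_mult using bb ij' R01 by (intro mult_mono) auto
          then show "\<bar>Y $ i $ j\<bar> \<le> R" using RR by (simp add: Y_def b_def symB'[of v])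
        qed (use C d in simp)
        then show ?thesis by (simp add: L_def mult_ac)
      qed
      have 4: "\<bar>(B' $ v $ v - A $ v $ v) * principal_minor B' K\<bar> \<le> d * (m + 1)"
        unfolding abs_mult using bvv mB[of K] mB'[of K] K d by (intro mult_mono) auto
      have 5: "\<bar>A $ v $ v * (principal_minor B' K - principal_minor A K)\<bar> \<le> R0 * d"
        unfolding abs_mult using H K d A0[of v v] R01 C m0
        by (intro mult_mono) (auto simp: mB' R0_def)
      have 6: "\<bar>principal_minor B' (insert v K) - principal_minor A (insert v K)\<bar> \<le> d"
        using H[rule_format, of "insert v K"] K mB' by auto
      have "minor_deriv A X K = (minor_deriv A Y K - minor_deriv B' Y K)
          + (B' $ v $ v - A $ v $ v) * principal_minor B' K
          + A $ v $ v * (principal_minor B' K - principal_minor A K)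
          - (principal_minor B' (insert v K) - principal_minor A (insert v K))"
        unfolding XYW minor_deriv_diff using 1 2 by (simp add: algebra_simps)
      moreover have "(L * C + (m + 1) + R0 + 1) * d = L * (C * d) + d * (m + 1) + R0 * d + d"
        by (simp add: algebra_simps)
      ultimately show ?thesis using 3 4 5 6 by linarith
    qed
    have Xb: "\<bar>b i * b j - a i * a j\<bar> \<le> C1 * d" if "i \<in> S" "j \<in> S" for i j
      using Q'[OF sX _ XK that] d L0 C m0 R01 by (simp add: C1_def X_def mult.assoc)
    \<comment> \<open>Products of entries of \<open>b\<close> fix the column only up to one common
      sign; \<open>t\<close> aligns it with \<open>a\<close> at \<open>u\<close>, with the tie
      \<open>b u = 0\<close> resolved to 1.\<close>
    define t :: real where "t = (if b u * a u \<ge> 0 then 1 else -1)"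
    have t: "t = 1 \<or> t = -1" by (simp add: t_def)
    have tt: "t * t = 1" using t by auto
    have sgn: "t * b u * a u \<ge> 0" by (auto simp: t_def)
    have bu: "\<bar>t * b u - a u\<bar> \<le> C2 * d"
    proof -
      \<comment> \<open>Aligned terms do not cancel, so dividing the difference of squares by their
        sum is safe.\<close>
      have "a0 \<le> \<bar>t * b u + a u\<bar>"
        using sgn unfolding a0_def by (auto simp: zero_le_mult_iff)
      then have "\<bar>t * b u - a u\<bar> * a0 \<le> \<bar>t * b u - a u\<bar> * \<bar>t * b u + a u\<bar>"
        by (intro mult_left_mono) auto
      also have "\<dots> = \<bar>(t * t) * (b u * b u) - a u * a u\<bar>"
        unfolding abs_mult[symmetric] by (simp add: algebra_simps)
      also have "\<dots> \<le> C1 * d" using Xb insert.hyps by (simp add: tt)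
      finally show ?thesis using a0 by (simp add: C2_def field_simps)
    qed
    have bj: "\<bar>t * b j - a j\<bar> \<le> C3 * d" if j: "j \<in> S" for j
    proof -
      \<comment> \<open>Passing through \<open>b j * b u\<close> transfers the sign chosen at
        \<open>u\<close> to every other \<open>j\<close>.\<close>
      have "(t * b j - a j) * a u = - ((t * b j) * (t * b u - a u)) + ((t * t) * (b j * b u) - a j * a u)"
        by (simp add: algebra_simps)
      moreover have "\<bar>(t * b j) * (t * b u - a u)\<bar> \<le> R0 * (C2 * d)"
        unfolding abs_mult using bb[OF j] bu t R01 by (intro mult_mono) auto
      moreover have "\<bar>(t * t) * (b j * b u) - a j * a u\<bar> \<le> C1 * d"
        using Xb[OF j insert.hyps(3)] by (simp add: tt)
      ultimately have "\<bar>(t * b j - a j) * a u\<bar> \<le> R0 * (C2 * d) + C1 * d" by linarith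
      then have "\<bar>t * b j - a j\<bar> * a0 \<le> R0 * (C2 * d) + C1 * d" by (simp add: abs_mult a0_def)
      then show ?thesis using a0 by (simp add: C3_def field_simps)
    qed
    \<comment> \<open>Only the sign at \<open>v\<close> changes: entries in \<open>S\<close> are
      untouched, and the diagonal entry at \<open>v\<close> sees the sign squared.\<close>
    define s' where "s' i = (if i = v then t * s v else s i)" for i
    have ge: "d \<le> (1 + C + C3) * d" "C * d \<le> (1 + C + C3) * d" "C3 * d \<le> (1 + C + C3) * d"
      using C C3 d by (simp_all add: algebra_simps add_nonneg_nonneg)
    show "\<exists>s. (\<forall>i. s i = 1 \<or> s i = -1) \<and> (\<forall>i\<in>insert v S. \<forall>j\<in>insert v S.
        \<bar>s i * s j * B $ i $ j - A $ i $ j\<bar> \<le> (1 + C + C3) * d)"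
    proof (intro exI[of _ s'] conjI allI ballI)
      show "s' i = 1 \<or> s' i = -1" for i using s[of i] s[of v] t by (auto simp: s'_def)
      fix i j assume i: "i \<in> insert v S" and j: "j \<in> insert v S"
      have v1: "\<bar>s' i * s' v * B $ i $ v - A $ i $ v\<bar> \<le> (1 + C + C3) * d" if "i \<in> S" for i
      proof -
        have "s' i * s' v * B $ i $ v = t * b i"
          using that insert.hyps by (auto simp: s'_def b_def B'ij)
        then show ?thesis using bj[OF that] ge by (simp add: a_def)
      qed
      show "\<bar>s' i * s' j * B $ i $ j - A $ i $ j\<bar> \<le> (1 + C + C3) * d"
      proof (cases "i = v"; cases "j = v")
        assume "i = v" "j = v"
        moreover have "s' v * s' v = s v * s v" using t by (auto simp: s'_def)
        ultimately show ?thesis using bvv ge by (simp add: B'ij)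
      next
        assume "i = v" "j \<noteq> v"
        then show ?thesis using v1[of j] j transpose_nth_eq[OF sB, of v j] transpose_nth_eq[OF sym, of v j]
          by (auto simp: mult.commute)
      next
        assume "i \<noteq> v" "j = v" then show ?thesis using v1[of i] i by auto
      next
        assume "i \<noteq> v" "j \<noteq> v"
        then show ?thesis using sS[of i j] ge i j by (auto simp: s'_def)
      qed
    qed
  qed
qed

text \<open>If a maximal grown subset \<open>S\<close> of \<open>J\<close> were proper, no nonzero
  entry would join \<open>S\<close> to \<open>J - S\<close>; replacing \<open>J\<close> by these two
  pieces would give a block partition with one more set, against maximality of
  \<open>P\<close>.\<close>

lemma block_grown:
  fixes A :: "real ^ 'n ^ 'n"
  assumes P: "are_blocks A P" and J: "J \<in> P" and sym: "transpose A = A"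
  shows "grown A J"
proof -
  have part: "partition_on UNIV P"
    and sep: "\<And>I I' i j. I \<in> P \<Longrightarrow> I' \<in> P \<Longrightarrow> I \<noteq> I' \<Longrightarrow> i \<in> I \<Longrightarrow> j \<in> I' \<Longrightarrow> A $ i $ j = 0"
    and max: "\<And>Q. block_partition A Q \<Longrightarrow> card Q \<le> card P"
    using P unfolding are_blocks_def block_partition_def by auto
  have "J \<noteq> {}" using part J by (auto simp: partition_on_def)
  then obtain v where v: "v \<in> J" by auto
  obtain S where S: "S \<subseteq> J" "grown A S" and Smax: "\<And>T. T \<subseteq> J \<Longrightarrow> grown A T \<Longrightarrow> S \<subseteq> T \<Longrightarrow> S = T"
    using finite_has_maximal2[of "{T. T \<subseteq> J \<and> grown A T}" "{v}"] v grown.single[of A v] by auto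
  have "S = J"
  proof (rule ccontr)
    assume "S \<noteq> J"
    then have SJ: "S \<subset> J" using S by auto
    have no: "A $ i $ j = 0" if "i \<in> S" "j \<in> J - S" for i j
    proof (rule ccontr)
      assume "A $ i $ j \<noteq> 0"
      then have "grown A (insert j S)" using that S by (intro grown.insert) auto
      then have "S = insert j S" using that S by (intro Smax) auto
      then show False using that by auto
    qed
    have no': "A $ i $ j = 0" if "j \<in> S" "i \<in> J - S" for i j
      using no[OF that] transpose_nth_eq[OF sym] by metis
    have Sne: "S \<noteq> {}" using S(2) by cases auto
    define Q where "Q = insert S (insert (J - S) (P - {J}))"
    have dis: "I \<inter> J = {}" if "I \<in> P" "I \<noteq> J" for I
      using part that J by (auto simp: partition_on_def disjoint_def)
    have new: "S \<notin> P - {J}" "J - S \<notin> P - {J}" "S \<noteq> J - S"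
      using dis[of S] dis[of "J - S"] SJ Sne by auto
    have "partition_on UNIV Q"
    proof (rule partition_onI)
      show "\<Union> Q = UNIV" using part SJ J unfolding Q_def partition_on_def by blast
      show "disjnt p q" if "p \<in> Q" "q \<in> Q" "p \<noteq> q" for p q
        using that dis SJ part unfolding Q_def disjnt_def partition_on_def disjoint_def by blast
      show "{} \<notin> Q"
        using SJ Sne part unfolding Q_def partition_on_def by auto
    qed
    moreover have "A $ i $ j = 0" if I: "I \<in> Q" "I' \<in> Q" "I \<noteq> I'" "i \<in> I" "j \<in> I'" for I I' i j
    proof -
      consider "I \<in> P - {J}" "I' \<in> P - {J}" | "I \<in> P - {J}" "I' \<subseteq> J" | "I \<subseteq> J" "I' \<in> P - {J}"
        | "I = S" "I' = J - S" | "I = J - S" "I' = S"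
        using I SJ unfolding Q_def by blast
      then show ?thesis
      proof cases
        case 2 then show ?thesis using sep[of I J i j] I J by auto
      next
        case 3 then show ?thesis using sep[of J I' i j] I J by auto
      qed (use sep[of I I' i j] I no no' in auto)
    qed
    ultimately have "block_partition A Q" unfolding block_partition_def by blast
    then have "card Q \<le> card P" by (rule max)
    moreover have "card Q = Suc (Suc (card (P - {J})))" unfolding Q_def using new by simp
    moreover have "card P = Suc (card (P - {J}))" using card_Suc_Diff1[OF finite J] by metis
    ultimately show False by simp
  qed
  with S show ?thesis by simp
qed

subsection \<open>Likelihood and existence of maximizers\<close>

text \<open>Expanding each Leibniz product chooses the set \<open>K\<close> of indices that take
  their factor from \<open>A\<close>. The identity factors elsewhere vanish unless the permutation
  fixes the complement of \<open>K\<close>, leaving the minor over \<open>K\<close>. Thus the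
  normalizer of a DPP is the sum of all minors.\<close>

lemma det_one_plus: "det (mat 1 + A) = (\<Sum>K\<in>UNIV. principal_minor A K)" for A :: "real ^ 'n ^ 'n"
proof -
  have "det (mat 1 + A) = (\<Sum>p | p permutes (UNIV :: 'n set). \<Sum>K\<in>UNIV.
      of_int (sign p) * ((\<Prod>i\<in>K. A $ i $ p i) * (\<Prod>i\<in>-K. if i = p i then 1 else 0)))"
    unfolding det_def
    by (intro sum.cong refl)
      (simp add: mat_def prod_add add.commute[of "if _ then _ else _"] sum_distrib_left Compl_eq_Diff_UNIV)
  also have "\<dots> = (\<Sum>K\<in>UNIV. \<Sum>p | p permutes (UNIV :: 'n set).
      of_int (sign p) * ((\<Prod>i\<in>K. A $ i $ p i) * (\<Prod>i\<in>-K. if i = p i then 1 else 0)))"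
    by (rule sum.swap)
  also have "\<dots> = (\<Sum>K\<in>UNIV. principal_minor A K)"
  proof (rule sum.cong[OF refl])
    fix K :: "'n set"
    have "(\<Sum>p | p permutes K. of_int (sign p) * (\<Prod>i\<in>K. A $ i $ p i)) =
       (\<Sum>p | p permutes (UNIV :: 'n set).
      of_int (sign p) * ((\<Prod>i\<in>K. A $ i $ p i) * (\<Prod>i\<in>-K. if i = p i then 1 else 0)))"
    proof (rule sum.mono_neutral_cong_left)
      show "{p. p permutes K} \<subseteq> {p. p permutes UNIV}" using permutes_subset by auto
      show "\<forall>p\<in>{p. p permutes UNIV} - {p. p permutes K}.
        of_int (sign p) * ((\<Prod>i\<in>K. A $ i $ p i) * (\<Prod>i\<in>-K. if i = p i then 1 else 0)) = 0"
      proof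
        fix p assume p: "p \<in> {p. p permutes UNIV} - {p. p permutes K}"
        then obtain i where "i \<notin> K" "p i \<noteq> i" unfolding permutes_def by blast
        then have "(\<Prod>i\<in>-K. if i = p i then 1 else (0::real)) = 0"
          by (intro prod_zero) (auto intro!: bexI[of _ i])
        then show "of_int (sign p) * ((\<Prod>i\<in>K. A $ i $ p i) * (\<Prod>i\<in>-K. if i = p i then 1 else 0)) = 0"
          by simp
      qed
      show "of_int (sign p) * (\<Prod>i\<in>K. A $ i $ p i) =
        of_int (sign p) * ((\<Prod>i\<in>K. A $ i $ p i) * (\<Prod>i\<in>-K. if i = p i then 1 else 0))"
        if "p \<in> {p. p permutes K}" for p
      proof -
        have "(\<Prod>i\<in>-K. if i = p i then 1 else (0::real)) = 1"
          using that by (intro prod.neutral) (auto simp: permutes_not_in)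
        then show ?thesis by simp
      qed
    qed simp
    then show "(\<Sum>p | p permutes (UNIV :: 'n set).
      of_int (sign p) * ((\<Prod>i\<in>K. A $ i $ p i) * (\<Prod>i\<in>-K. if i = p i then 1 else 0))) = principal_minor A K"
      by (simp add: principal_minor_def)
  qed
  finally show ?thesis .
qed

text \<open>Padding with the identity outside \<open>K\<close> turns a minor into a full
  determinant, to which results on \<open>det\<close> apply.\<close>

lemma principal_minor_eq_det:
  "principal_minor A K = det (\<chi> i j. if i \<in> K \<and> j \<in> K then A $ i $ j else if i = j then 1 else 0)"
  for A :: "real ^ 'n ^ 'n"
  unfolding principal_minor_def det_def
proof (rule sum.mono_neutral_cong_left)
  let ?B = "\<chi> i j. if i \<in> K \<and> j \<in> K then A $ i $ j else if i = j then 1 else 0"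
  show "{p. p permutes K} \<subseteq> {p. p permutes UNIV}" using permutes_subset by auto
  show "\<forall>p\<in>{p. p permutes UNIV} - {p. p permutes K}. of_int (sign p) * (\<Prod>i\<in>UNIV. ?B $ i $ p i) = 0"
  proof
    fix p assume p: "p \<in> {p. p permutes UNIV} - {p. p permutes K}"
    then obtain i where "i \<notin> K" "p i \<noteq> i" unfolding permutes_def by blast
    then have "(\<Prod>i\<in>UNIV. ?B $ i $ p i) = 0" by (intro prod_zero) (auto intro!: bexI[of _ i])
    then show "of_int (sign p) * (\<Prod>i\<in>UNIV. ?B $ i $ p i) = 0" by simp
  qed
  show "of_int (sign p) * (\<Prod>i\<in>K. A $ i $ p i) = of_int (sign p) * (\<Prod>i\<in>UNIV. ?B $ i $ p i)"
    if "p \<in> {p. p permutes K}" for p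
  proof -
    have "(\<Prod>i\<in>K. A $ i $ p i) = (\<Prod>i\<in>UNIV. ?B $ i $ p i)"
      using that by (intro prod.mono_neutral_cong_left) (auto simp: permutes_not_in permutes_in_image)
    then show ?thesis by simp
  qed
qed simp

section \<open>Positive definite matrices and positivity of DPP probabilities\<close>

lemma det_nonzero_if_spd:
  fixes A :: "real ^ 'n ^ 'n"
  assumes "A \<in> spd" shows "det A \<noteq> 0"
proof
  assume "det A = 0"
  then obtain x where "x \<noteq> 0" "A *v x = 0"
    by (metis invertible_det_nz invertible_left_inverse matrix_left_invertible_ker)
  then show False using assms by (auto simp: spd_def)
qed

lemma spd_convex:
  fixes A B :: "real ^ 'n ^ 'n"
  assumes "A \<in> spd" "B \<in> spd" "0 \<le> t" "t \<le> 1"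
  shows "(1 - t) *\<^sub>R A + t *\<^sub>R B \<in> spd"
  unfolding spd_def
proof (intro CollectI conjI allI impI)
  show "transpose ((1 - t) *\<^sub>R A + t *\<^sub>R B) = (1 - t) *\<^sub>R A + t *\<^sub>R B"
    using assms by (simp add: spd_def vec_eq_iff transpose_def)
  fix x :: "real ^ 'n" assume x: "x \<noteq> 0"
  have "x \<bullet> (A *v x) > 0" "x \<bullet> (B *v x) > 0" using assms x by (auto simp: spd_def)
  then have "(1 - t) * (x \<bullet> (A *v x)) + t * (x \<bullet> (B *v x)) > 0"
    using assms(3,4) by (cases "t = 0") (auto intro!: add_nonneg_pos mult_nonneg_nonneg)
  then show "x \<bullet> (((1 - t) *\<^sub>R A + t *\<^sub>R B) *v x) > 0"
    by (simp add: matrix_vector_mult_add_rdistrib scaleR_matrix_vector_assoc[symmetric] inner_add_right)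
qed

lemma mat1_spd: "mat 1 \<in> spd"
  by (simp add: spd_def transpose_mat)

lemma continuous_on_det_real [continuous_intros]:
  fixes f :: "'a::topological_space \<Rightarrow> real ^ 'n ^ 'n"
  assumes "continuous_on S f" shows "continuous_on S (\<lambda>x. det (f x))"
  unfolding det_def using assms by (intro continuous_intros)

lemma continuous_on_principal_minor [continuous_intros]:
  fixes f :: "'a::topological_space \<Rightarrow> real ^ 'n ^ 'n"
  assumes "continuous_on S f" shows "continuous_on S (\<lambda>x. principal_minor (f x) K)"
  unfolding principal_minor_def using assms by (intro continuous_intros)

text \<open>The segment from the identity to \<open>A\<close> stays in \<open>spd\<close>, where the
  determinant never vanishes; it starts at 1 and therefore remains positive.\<close>

lemma det_pos_if_spd:
  fixes A :: "real ^ 'n ^ 'n"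
  assumes "A \<in> spd" shows "det A > 0"
proof (rule ccontr)
  let ?f = "\<lambda>t. det ((1 - t) *\<^sub>R mat 1 + t *\<^sub>R A)"
  assume "\<not> det A > 0"
  then have "?f 1 \<le> 0" "0 \<le> ?f 0" by auto
  moreover have "continuous_on {0..1} ?f" by (intro continuous_intros)
  ultimately obtain t where "0 \<le> t" "t \<le> 1" "?f t = 0" using IVT2'[of ?f 1 0 0] by auto
  then show False using det_nonzero_if_spd[OF spd_convex[OF mat1_spd assms]] by blast
qed

lemma principal_minor_pos_if_spd:
  fixes A :: "real ^ 'n ^ 'n"
  assumes A: "A \<in> spd" shows "principal_minor A K > 0"
  unfolding principal_minor_eq_det
proof (rule det_pos_if_spd, unfold spd_def, intro CollectI conjI allI impI)
  let ?B = "\<chi> i j. if i \<in> K \<and> j \<in> K then A $ i $ j else if i = j then 1 else 0"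
  have sym: "A $ i $ j = A $ j $ i" for i j
    using A by (intro transpose_nth_eq) (simp add: spd_def)
  show "transpose ?B = ?B" by (auto simp: transpose_def vec_eq_iff sym)
  fix x :: "real ^ 'n" assume x: "x \<noteq> 0"
  \<comment> \<open>The padded matrix acts as \<open>A\<close> on the part \<open>y\<close> of
    \<open>x\<close> in \<open>K\<close> and as the identity on the part \<open>z\<close>
    outside.\<close>
  define y where "y = (\<chi> i. if i \<in> K then x $ i else 0)"
  define z where "z = (\<chi> i. if i \<in> K then 0 else x $ i)"
  have "?B *v x = (\<chi> i. if i \<in> K then (A *v y) $ i else x $ i)"
  proof (simp add: vec_eq_iff, intro allI conjI impI)
    fix i assume i: "i \<in> K"
    show "(?B *v x) $ i = (A *v y) $ i"
      unfolding matrix_vector_mult_def y_def using i by (auto intro!: sum.cong)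
  next
    fix i assume i: "i \<notin> K"
    have "(?B *v x) $ i = (\<Sum>j\<in>UNIV. (if i = j then 1 else 0) * x $ j)"
      unfolding matrix_vector_mult_def using i by simp
    also have "\<dots> = (\<Sum>j\<in>UNIV. if i = j then x $ j else 0)" by (rule sum.cong) auto
    finally show "(?B *v x) $ i = x $ i" by simp
  qed
  then have "x \<bullet> (?B *v x) = y \<bullet> (A *v y) + z \<bullet> z"
    unfolding inner_vec_def sum.distrib[symmetric] y_def z_def by (auto intro!: sum.cong)
  moreover have "y \<noteq> 0 \<or> z \<noteq> 0" using x by (auto simp: y_def z_def vec_eq_iff)
  moreover have "y \<bullet> (A *v y) > 0" if "y \<noteq> 0" using A that by (auto simp: spd_def)
  ultimately show "x \<bullet> (?B *v x) > 0"
    by (cases "y = 0") (auto simp: add_pos_nonneg)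
qed

lemma det_one_plus_ge_1: "A \<in> spd \<Longrightarrow> det (mat 1 + A) \<ge> 1"
  unfolding det_one_plus
  using member_le_sum[of "{}" UNIV "principal_minor A"] principal_minor_pos_if_spd[of A]
  by (auto simp: principal_minor_empty less_imp_le)

lemma principal_minor_le_det: "A \<in> spd \<Longrightarrow> principal_minor A K \<le> det (mat 1 + A)"
  unfolding det_one_plus
  using member_le_sum[of K UNIV "principal_minor A"] principal_minor_pos_if_spd[of A]
  by (auto simp: less_imp_le)

lemma dpp_prob_pos: "A \<in> spd \<Longrightarrow> dpp_prob A K > 0"
  using det_one_plus_ge_1[of A] principal_minor_pos_if_spd[of A K] by (simp add: dpp_prob_def)

lemma sum_dpp_prob: "A \<in> spd \<Longrightarrow> (\<Sum>K\<in>UNIV. dpp_prob A K) = 1"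
  using det_one_plus_ge_1[of A] unfolding dpp_prob_def
  by (simp add: sum_divide_distrib[symmetric] det_one_plus[symmetric])

lemma dpp_prob_le_1: "A \<in> spd \<Longrightarrow> dpp_prob A K \<le> 1"
  using principal_minor_le_det[of A K] det_one_plus_ge_1[of A] by (simp add: dpp_prob_def)

text \<open>This replaces the open condition in \<open>spd\<close> by closed ones. If the form
  vanished at a nonzero \<open>x\<close>, then \<open>y = A *v x\<close> would be nonzero, and
  moving \<open>x\<close> slightly against \<open>y\<close> would make the form negative.\<close>

lemma spd_if_psd_det_nonzero:
  fixes A :: "real ^ 'n ^ 'n"
  assumes sym: "transpose A = A" and psd: "\<And>x. 0 \<le> x \<bullet> (A *v x)" and det: "det A \<noteq> 0"
  shows "A \<in> spd"
  unfolding spd_def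
proof (intro CollectI conjI allI impI sym)
  fix x :: "real ^ 'n" assume x: "x \<noteq> 0"
  show "x \<bullet> (A *v x) > 0"
  proof (rule ccontr)
    assume "\<not> x \<bullet> (A *v x) > 0"
    then have x0: "x \<bullet> (A *v x) = 0" using psd[of x] by linarith
    define y where "y = A *v x"
    have yx: "x \<bullet> (A *v y) = y \<bullet> y"
      using dot_lmul_matrix[of x A y] sym by (metis inner_commute transpose_matrix_vector y_def)
    have y: "y \<noteq> 0"
      using x det unfolding y_def by (metis invertible_det_nz invertible_left_inverse matrix_left_invertible_ker)
    define c where "c = y \<bullet> (A *v y)"
    have q: "0 \<le> 2 * t * (y \<bullet> y) + t\<^sup>2 * c" for t
    proof -
      have "(x + t *\<^sub>R y) \<bullet> (A *v (x + t *\<^sub>R y)) = 2 * t * (y \<bullet> y) + t\<^sup>2 * c"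
        using x0 yx by (simp add: matrix_vector_right_distrib matrix_vector_mult_scaleR
          inner_add_left inner_add_right c_def power2_eq_square y_def[symmetric] algebra_simps)
      then show ?thesis using psd by metis
    qed
    have c: "c \<ge> 0" using psd by (simp add: c_def)
    have yy: "y \<bullet> y > 0" using y by simp
    \<comment> \<open>The step is near the minimizer of the quadratic in \<open>t\<close>; the
      denominator \<open>c + 1\<close> also covers \<open>c = 0\<close>.\<close>
    have "2 * (- (y \<bullet> y) / (c + 1)) * (y \<bullet> y) + (- (y \<bullet> y) / (c + 1))\<^sup>2 * c
        = (y \<bullet> y)\<^sup>2 / (c + 1)\<^sup>2 * (c - 2 * (c + 1))"
      using c by (simp add: divide_simps power2_eq_square) (simp add: algebra_simps)
    also have "\<dots> < 0" using yy c by (intro mult_pos_neg) auto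
    finally show False using q[of "- (y \<bullet> y) / (c + 1)"] by linarith
  qed
qed

section \<open>Compactness and existence of maximizers\<close>

lemma norm_matrix_le:
  fixes A :: "real ^ 'n ^ 'm"
  assumes "\<And>i j. \<bar>A $ i $ j\<bar> \<le> e"
  shows "norm A \<le> real CARD('m) * (real CARD('n) * e)"
proof -
  have "norm A \<le> (\<Sum>i\<in>UNIV. norm (A $ i))"
    unfolding norm_vec_def by (rule L2_set_le_sum) (auto intro: L2_set_nonneg)
  also have "\<dots> \<le> (\<Sum>i\<in>(UNIV::'m set). \<Sum>j\<in>(UNIV::'n set). e)"
    using assms by (intro sum_mono order_trans[OF norm_le_l1_cart]) auto
  finally show ?thesis by simp
qed

text \<open>Every summand is nonpositive, so where the objective is at least its value
  \<open>f0\<close> at the identity, each single summand is at least \<open>f0\<close>. As all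
  weights are positive, all probabilities are then at least \<open>c\<close>, which confines such
  \<open>L\<close> to a compact subset of \<open>spd\<close>.\<close>

lemma dpp_loglik_maximizer_exists:
  fixes w :: "'n::finite set \<Rightarrow> real"
  assumes w: "\<And>K. w K > 0"
  shows "\<exists>L. is_arg_max (\<lambda>L :: real ^ 'n ^ 'n. \<Sum>K\<in>UNIV. w K * ln (dpp_prob L K)) (\<lambda>L. L \<in> spd) L"
proof -
  let ?f = "\<lambda>L :: real ^ 'n ^ 'n. \<Sum>K\<in>UNIV. w K * ln (dpp_prob L K)"
  define f0 where "f0 = ?f (mat 1)"
  define c where "c = Min (range (\<lambda>K. exp (f0 / w K)))"
  have c0: "c > 0" unfolding c_def by (subst Min_gr_iff) auto
  have cK: "c \<le> exp (f0 / w K)" for K unfolding c_def by (rule Min_le) auto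
  \<comment> \<open>Only closed conditions appear; the lower bound on the full minor restores
    positive definiteness.\<close>
  define T where "T = {L :: real ^ 'n ^ 'n. (\<forall>i j. L $ i $ j = L $ j $ i) \<and> (\<forall>x. 0 \<le> x \<bullet> (L *v x)) \<and>
     (\<forall>K. c \<le> principal_minor L K) \<and> (\<forall>i. L $ i $ i \<le> 1 / c)}"
  have T_sub: "T \<subseteq> spd"
  proof
    fix L assume "L \<in> T"
    then have L: "\<And>i j. L $ i $ j = L $ j $ i" "\<And>x. 0 \<le> x \<bullet> (L *v x)" "c \<le> principal_minor L UNIV"
      unfolding T_def by auto
    then show "L \<in> spd"
      using c0 by (intro spd_if_psd_det_nonzero) (auto simp: vec_eq_iff transpose_def principal_minor_UNIV)
  qed
  have T_sup: "L \<in> T" if L: "L \<in> spd" and f: "?f L \<ge> f0" for L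
  proof -
    have p: "dpp_prob L K \<ge> c" for K
    proof -
      have "?f L = w K * ln (dpp_prob L K) + (\<Sum>K\<in>UNIV - {K}. w K * ln (dpp_prob L K))"
        by (rule sum.remove) auto
      moreover have "(\<Sum>K\<in>UNIV - {K}. w K * ln (dpp_prob L K)) \<le> 0"
        using w dpp_prob_pos[OF L] dpp_prob_le_1[OF L]
        by (intro sum_nonpos mult_nonneg_nonpos) (auto simp: less_imp_le)
      ultimately have "f0 \<le> w K * ln (dpp_prob L K)" using f by linarith
      then have "f0 / w K \<le> ln (dpp_prob L K)" using w[of K] by (simp add: field_simps)
      then have "exp (f0 / w K) \<le> dpp_prob L K" using dpp_prob_pos[OF L, of K] by (simp add: ln_ge_iff)
      then show ?thesis using cK[of K] by linarith
    qed
    note d1 = det_one_plus_ge_1[OF L]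
    \<comment> \<open>The empty minor is 1, so the probability of \<open>{}\<close> bounds the
      normalizer from above.\<close>
    have "c \<le> 1 / det (mat 1 + L)" using p[of "{}"] by (simp add: dpp_prob_def principal_minor_empty)
    then have dc: "det (mat 1 + L) \<le> 1 / c" using d1 c0 by (simp add: field_simps)
    have "c \<le> principal_minor L K" for K
    proof -
      have "c \<le> c * det (mat 1 + L)" using c0 d1 by simp
      also have "\<dots> \<le> principal_minor L K" using p[of K] d1 by (simp add: dpp_prob_def field_simps)
      finally show ?thesis .
    qed
    moreover have "L $ i $ i \<le> 1 / c" for i
      using principal_minor_le_det[OF L, of "{i}"] dc by (simp add: principal_minor_singleton)
    moreover have "0 \<le> x \<bullet> (L *v x)" for x using L by (cases "x = 0") (auto simp: spd_def less_imp_le)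
    moreover have "L $ i $ j = L $ j $ i" for i j
      using L by (intro transpose_nth_eq) (simp add: spd_def)
    ultimately show ?thesis by (auto simp: T_def)
  qed
  have "closed T"
    unfolding T_def Collect_conj_eq Collect_all_eq matrix_vector_mult_def
    by (intro closed_Int closed_INT ballI closed_Collect_eq closed_Collect_le continuous_intros)
  moreover have "bounded T"
  proof (rule boundedI)
    fix L assume L: "L \<in> T"
    have dg: "0 \<le> L $ i $ i" "L $ i $ i \<le> 1 / c" for i
    proof -
      have "c \<le> principal_minor L {i}" "L $ i $ i \<le> 1 / c" using L by (simp_all add: T_def)
      then show "0 \<le> L $ i $ i" "L $ i $ i \<le> 1 / c" using c0 by (simp_all add: principal_minor_singleton)
    qed
    have e: "\<bar>L $ i $ j\<bar> \<le> 1 / c" for i j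
    proof (cases "i = j")
      case False
      have "c \<le> principal_minor L {i, j}" "L $ j $ i = L $ i $ j" using L by (auto simp: T_def)
      then have "(L $ i $ j)\<^sup>2 \<le> L $ i $ i * L $ j $ j"
        using c0 False by (simp add: principal_minor_pair power2_eq_square)
      also have "\<dots> \<le> (1 / c) * (1 / c)" using dg c0 by (intro mult_mono) auto
      finally have "\<bar>L $ i $ j\<bar> \<le> \<bar>1 / c\<bar>"
        by (intro power2_le_imp_le[of "\<bar>L $ i $ j\<bar>"]) (auto simp: power2_eq_square)
      then show ?thesis using c0 by simp
    qed (use dg in auto)
    show "norm L \<le> real CARD('n) * (real CARD('n) * (1 / c))"
      using e by (rule norm_matrix_le)
  qed
  ultimately have "compact T" by (simp add: compact_eq_bounded_closed)
  moreover have I: "mat 1 \<in> T" by (rule T_sup[OF mat1_spd]) (simp add: f0_def)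
  moreover have "continuous_on T ?f"
  proof -
    have nz: "det (mat 1 + L) \<noteq> 0" "dpp_prob L K \<noteq> 0" if "L \<in> T" for L K
      using that T_sub det_one_plus_ge_1[of L] dpp_prob_pos[of L K] by auto
    have "continuous_on T (\<lambda>L. dpp_prob L K)" for K
      unfolding dpp_prob_def using nz by (intro continuous_intros) auto
    then show ?thesis using nz by (intro continuous_intros) auto
  qed
  ultimately obtain L where L: "L \<in> T" and max: "\<And>L'. L' \<in> T \<Longrightarrow> ?f L' \<le> ?f L"
    using continuous_attains_sup[of T ?f] by blast
  have "?f L' \<le> ?f L" if "L' \<in> spd" for L'
    using T_sup[OF that] max[of L'] max[OF I] unfolding f0_def[symmetric] by linarith
  then have "is_arg_max ?f (\<lambda>L. L \<in> spd) L"
    using L T_sub by (auto simp: is_arg_max_def not_less)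
  then show ?thesis by blast
qed

section \<open>From likelihood comparison to closeness of minors\<close>

text \<open>The Kullback-Leibler divergence dominates the squared Hellinger distance and is dominated by the
  \<open>\<chi>\<^sup>2\<close>-divergence.\<close>

lemma likelihood_ratio_l2_bound:
  fixes w p q :: "'a::finite \<Rightarrow> real"
  assumes w: "\<And>x. w x > 0" "sum w UNIV = 1" and p: "\<And>x. p x > 0" "sum p UNIV = 1"
    and q: "\<And>x. q x > 0" "sum q UNIV = 1"
    and le: "(\<Sum>x\<in>UNIV. w x * ln (p x)) \<le> (\<Sum>x\<in>UNIV. w x * ln (q x))"
  shows "(\<Sum>x\<in>UNIV. (w x - q x)\<^sup>2) \<le> 4 * (\<Sum>x\<in>UNIV. (w x - p x)\<^sup>2 / p x)"
proof -
  have le1: "x \<le> 1" if "sum f UNIV = 1" "\<And>x. f x > 0" "x = f y" for f :: "'a \<Rightarrow> real" and x y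
    using member_le_sum[of y UNIV f] that by (auto simp: less_imp_le)
  have 1: "(w x - q x)\<^sup>2 \<le> 4 * (sqrt (w x) - sqrt (q x))\<^sup>2" for x
  proof -
    have "sqrt (w x) + sqrt (q x) \<le> 1 + 1" using le1[of w] le1[of q] w q by (intro add_mono) auto
    then have "(sqrt (w x) + sqrt (q x))\<^sup>2 \<le> 2\<^sup>2"
      using w(1)[of x] q(1)[of x] by (intro power_mono) (auto simp: less_imp_le simp del: real_sqrt_le_1_iff)
    then have "(sqrt (w x) + sqrt (q x))\<^sup>2 * (sqrt (w x) - sqrt (q x))\<^sup>2 \<le> 4 * (sqrt (w x) - sqrt (q x))\<^sup>2"
      by (intro mult_right_mono) auto
    moreover have "w x - q x = (sqrt (w x) + sqrt (q x)) * (sqrt (w x) - sqrt (q x))"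
      using w(1)[of x] q(1)[of x] by (simp add: algebra_simps less_imp_le)
    ultimately show ?thesis by (simp add: power_mult_distrib)
  qed
  \<comment> \<open>This is \<open>ln r \<le> r - 1\<close> at the square root of
    \<open>q x / w x\<close>, multiplied by \<open>2 * w x\<close>. The correction
    \<open>q x - w x\<close> sums to zero.\<close>
  have 2: "(sqrt (w x) - sqrt (q x))\<^sup>2 \<le> (q x - w x) + (w x * ln (w x) - w x * ln (q x))" for x
  proof -
    have combine: "S \<le> (y - v) + (lv - ly)" if "a \<le> b - v" "b = s" "a = (ly - lv) / 2" "S = v + y - 2 * s"
      for S v y lv ly a b s :: real
      using that by (simp add: field_simps)
    define r where "r = sqrt (q x) / sqrt (w x)"
    have wx: "sqrt (w x) > 0" "sqrt (q x) > 0" using w q by auto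
    have "ln r \<le> r - 1" using wx by (intro ln_le_minus_one) (simp add: r_def)
    then have "w x * ln r \<le> w x * (r - 1)" using w(1)[of x] by simp
    then have "w x * ln r \<le> w x * r - w x" by (simp add: right_diff_distrib)
    moreover have "w x * r = sqrt (w x) * sqrt (q x)"
      using wx w(1)[of x] by (simp add: r_def field_simps)
    moreover have "w x * ln r = (w x * ln (q x) - w x * ln (w x)) / 2"
      using w(1)[of x] q(1)[of x] wx by (simp add: r_def ln_div ln_sqrt algebra_simps)
    moreover have "(sqrt (w x) - sqrt (q x))\<^sup>2 = w x + q x - 2 * (sqrt (w x) * sqrt (q x))"
      using w(1)[of x] q(1)[of x] by (simp add: power2_diff)
    ultimately show ?thesis by (rule combine)
  qed
  have 3: "w x * ln (w x) - w x * ln (p x) \<le> (w x - p x)\<^sup>2 / p x + (w x - p x)" for x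
  proof -
    have "ln (w x / p x) \<le> w x / p x - 1" using w p by (intro ln_le_minus_one) simp
    then have "w x * ln (w x / p x) \<le> w x * (w x / p x - 1)" using w(1)[of x] by simp
    then show ?thesis using w(1)[of x] p(1)[of x]
      by (simp add: ln_div field_simps power2_eq_square)
  qed
  have "(\<Sum>x\<in>UNIV. (w x - q x)\<^sup>2) \<le> (\<Sum>x\<in>UNIV. 4 * ((q x - w x) + (w x * ln (w x) - w x * ln (q x))))"
    using 1 2 by (intro sum_mono) (smt (verit))
  also have "\<dots> = 4 * (\<Sum>x\<in>UNIV. w x * ln (w x) - w x * ln (q x))"
    using w q by (simp add: sum_distrib_left[symmetric] sum.distrib sum_subtractf)
  \<comment> \<open>The likelihood comparison enters here, exchanging \<open>q\<close> for
    \<open>p\<close>.\<close>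
  also have "\<dots> \<le> 4 * (\<Sum>x\<in>UNIV. w x * ln (w x) - w x * ln (p x))"
    using le by (simp add: sum_subtractf)
  also have "\<dots> \<le> 4 * (\<Sum>x\<in>UNIV. (w x - p x)\<^sup>2 / p x + (w x - p x))"
    using 3 by (intro mult_left_mono sum_mono) auto
  also have "\<dots> = 4 * (\<Sum>x\<in>UNIV. (w x - p x)\<^sup>2 / p x)"
    using w p by (simp add: sum.distrib sum_subtractf)
  finally show ?thesis .
qed

text \<open>The deterministic core of the rate, with \<open>w\<close> in the role of the empirical
  frequencies and \<open>L\<close> in that of the estimator. Positivity of \<open>w\<close> is part
  of the conclusion because the existence of a maximizer rests on it.\<close>

lemma principal_minors_close:
  fixes A :: "real ^ 'n ^ 'n"
  assumes A: "A \<in> spd"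
  shows "\<exists>C\<ge>0. \<exists>e0>0. \<forall>w e. (\<forall>K. \<bar>w K - dpp_prob A K\<bar> \<le> e) \<longrightarrow> e \<le> e0 \<longrightarrow> sum w UNIV = 1 \<longrightarrow>
    (\<forall>K. w K > 0) \<and> (\<forall>L\<in>spd. (\<Sum>K\<in>UNIV. w K * ln (dpp_prob A K)) \<le> (\<Sum>K\<in>UNIV. w K * ln (dpp_prob L K)) \<longrightarrow>
      (\<forall>K. \<bar>principal_minor L K - principal_minor A K\<bar> \<le> C * e))"
proof -
  let ?p = "dpp_prob A"
  let ?n = "real CARD('n set)"
  note p = dpp_prob_pos[OF A] dpp_prob_le_1[OF A] sum_dpp_prob[OF A]
  define pm where "pm = Min (range ?p)"
  have pm0: "pm > 0" unfolding pm_def by (subst Min_gr_iff) (auto simp: p)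
  have pmle: "pm \<le> ?p K" for K unfolding pm_def by (rule Min_le) auto
  \<comment> \<open>\<open>C1 * e\<close> bounds the distance of the two laws: the 1 leads from
    \<open>p\<close> to \<open>w\<close>, the root from \<open>w\<close> to
    \<open>q\<close>.\<close>
  define C1 where "C1 = 1 + sqrt (4 * ?n / pm)"
  have C1: "C1 > 0" unfolding C1_def using pm0 by (intro add_pos_nonneg) auto
  \<comment> \<open>The first bound keeps \<open>w\<close> positive, the second keeps the
    probability of \<open>{}\<close> under \<open>L\<close>, a denominator below, at least
    \<open>pm / 2\<close>.\<close>
  define e0 where "e0 = min (pm / 2) (pm / (2 * C1))"
  have e0: "e0 > 0" unfolding e0_def using pm0 C1 by simp
  define C where "C = 4 * C1 / pm\<^sup>2"
  have C: "C \<ge> 0" unfolding C_def using pm0 C1 by simp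
  show ?thesis
  proof (rule exI[of _ C], intro conjI C, rule exI[of _ e0], intro conjI allI impI ballI e0)
    fix w e K
    assume we: "\<forall>K. \<bar>w K - ?p K\<bar> \<le> e" and e: "e \<le> e0"
    show "w K > 0"
      using we[rule_format, of K] pmle[of K] e pm0 unfolding e0_def by linarith
  next
    fix w e L K
    assume we: "\<forall>K. \<bar>w K - ?p K\<bar> \<le> e" and e: "e \<le> e0" and sw: "sum w UNIV = 1" and L: "L \<in> spd"
      and le: "(\<Sum>K\<in>UNIV. w K * ln (?p K)) \<le> (\<Sum>K\<in>UNIV. w K * ln (dpp_prob L K))"
    let ?q = "dpp_prob L"
    note q = dpp_prob_pos[OF L] dpp_prob_le_1[OF L] sum_dpp_prob[OF L]
    have e_0: "0 \<le> e" using we[rule_format, of "{}"] by linarith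
    have w: "w K > 0" for K
      using we[rule_format, of K] pmle[of K] e pm0 unfolding e0_def by linarith
    have qp: "\<bar>?q K - ?p K\<bar> \<le> C1 * e" for K
    proof -
      have "(w K - ?q K)\<^sup>2 \<le> (\<Sum>K\<in>UNIV. (w K - ?q K)\<^sup>2)"
        by (rule member_le_sum) auto
      also have "\<dots> \<le> 4 * (\<Sum>K\<in>UNIV. (w K - ?p K)\<^sup>2 / ?p K)"
        by (rule likelihood_ratio_l2_bound) (use w sw p q le in auto)
      also have "\<dots> \<le> 4 * (\<Sum>K\<in>(UNIV::'n set set). e\<^sup>2 / pm)"
      proof (intro mult_left_mono sum_mono frac_le)
        fix K show "(w K - ?p K)\<^sup>2 \<le> e\<^sup>2"
          using we[rule_format, of K] e_0 by (simp add: abs_le_square_iff[symmetric])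
      qed (use pmle pm0 in auto)
      also have "\<dots> = (sqrt (4 * ?n / pm) * e)\<^sup>2"
        using pm0 by (simp add: power_mult_distrib)
      finally have "\<bar>w K - ?q K\<bar> \<le> sqrt (4 * ?n / pm) * e"
        by (rule abs_le_square_iff[THEN iffD2, THEN order_trans]) (use e_0 pm0 in simp)
      then show ?thesis using we[rule_format, of K] unfolding C1_def by (simp add: algebra_simps)
    qed
    let ?pe = "?p {}" and ?qe = "?q {}"
    have "C1 * e \<le> C1 * (pm / (2 * C1))"
      using e C1 unfolding e0_def by (intro mult_left_mono) auto
    then have "C1 * e \<le> pm / 2" using C1 by simp
    then have q0: "?qe \<ge> pm / 2" using qp[of "{}"] pmle[of "{}"] by linarith
    have pos: "?pe > 0" "?qe > 0" using p q by auto
    \<comment> \<open>Dividing by the probability of \<open>{}\<close> cancels the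
      normalizer.\<close>
    have mL: "principal_minor L K = ?q K / ?qe" and mA: "principal_minor A K = ?p K / ?pe"
      using det_one_plus_ge_1[OF A] det_one_plus_ge_1[OF L]
      by (simp_all add: dpp_prob_def principal_minor_empty)
    have "principal_minor L K - principal_minor A K = ((?q K - ?p K) * ?pe + ?p K * (?pe - ?qe)) / (?qe * ?pe)"
      unfolding mL mA using pos by (simp add: field_simps)
    also have "\<bar>\<dots>\<bar> \<le> (C1 * e + C1 * e) / (pm / 2 * pm)"
      unfolding abs_divide
    proof (intro frac_le)
      have "\<bar>(?q K - ?p K) * ?pe\<bar> \<le> C1 * e * 1"
        unfolding abs_mult using qp[of K] p(2)[of "{}"] pos C1 e_0 by (intro mult_mono) auto
      moreover have "\<bar>?p K * (?pe - ?qe)\<bar> \<le> 1 * (C1 * e)"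
        unfolding abs_mult using qp[of "{}"] p(1,2)[of K] by (intro mult_mono) (auto simp: abs_minus_commute)
      ultimately show "\<bar>(?q K - ?p K) * ?pe + ?p K * (?pe - ?qe)\<bar> \<le> C1 * e + C1 * e" by linarith
      have "pm / 2 * pm \<le> ?qe * ?pe" using q0 pmle[of "{}"] pm0 by (intro mult_mono) auto
      then show "pm / 2 * pm \<le> \<bar>?qe * ?pe\<bar>" by simp
    qed (use pm0 C1 e_0 in auto)
    also have "\<dots> = C * e" using pm0 by (simp add: C_def power2_eq_square field_simps)
    finally show "\<bar>principal_minor L K - principal_minor A K\<bar> \<le> C * e" .
  qed
qed

text \<open>Where \<open>A\<close> vanishes, the diagonal and the minor over \<open>{i, j}\<close>
  control the square of \<open>L $ i $ j\<close> to order \<open>d\<close>; the root of this is the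
  loss in rate between blocks.\<close>

lemma off_block_bound:
  fixes A :: "real ^ 'n ^ 'n"
  assumes sym: "transpose A = A" and dis: "J \<inter> J' = {}"
    and A0: "\<And>i j. i \<in> J \<Longrightarrow> j \<in> J' \<Longrightarrow> A $ i $ j = 0"
  shows "\<exists>C\<ge>0. \<forall>L d. transpose L = L \<longrightarrow> d \<le> 1 \<longrightarrow>
    (\<forall>K. \<bar>principal_minor L K - principal_minor A K\<bar> \<le> d) \<longrightarrow> norm (restrict_mat L J J') \<le> C * sqrt d"
proof -
  define m where "m = (\<Sum>K\<in>UNIV. \<bar>principal_minor A K\<bar>)"
  have m: "\<bar>principal_minor A K\<bar> \<le> m" for K unfolding m_def by (rule member_le_sum) auto
  have m0: "m \<ge> 0" using m[of "{}"] by linarith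
  define C where "C = real CARD('n) * (real CARD('n) * sqrt (2 * m + 2))"
  show ?thesis
  proof (intro exI[of _ C] conjI allI impI)
    show "C \<ge> 0" unfolding C_def using m0 by simp
    fix L :: "real ^ 'n ^ 'n" and d
    assume sL: "transpose L = L" and d1: "d \<le> 1"
      and H: "\<forall>K. \<bar>principal_minor L K - principal_minor A K\<bar> \<le> d"
    have d0: "0 \<le> d" using H[rule_format, of "{}"] by linarith
    have dg: "\<bar>L $ i $ i - A $ i $ i\<bar> \<le> d" "\<bar>A $ i $ i\<bar> \<le> m" for i
      using H[rule_format, of "{i}"] m[of "{i}"] by (simp_all add: principal_minor_singleton)
    have "\<bar>L $ i $ j\<bar> \<le> sqrt (2 * m + 2) * sqrt d" if ij: "i \<in> J" "j \<in> J'" for i j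
    proof -
      have ne: "i \<noteq> j" using ij dis by auto
      have "(L $ i $ j)\<^sup>2 = (L $ i $ i - A $ i $ i) * L $ j $ j + A $ i $ i * (L $ j $ j - A $ j $ j)
          - (principal_minor L {i, j} - principal_minor A {i, j})"
        using ne A0[OF ij] transpose_nth_eq[OF sL, of j i]
        by (simp add: principal_minor_pair power2_eq_square algebra_simps)
      moreover have "\<bar>(L $ i $ i - A $ i $ i) * L $ j $ j\<bar> \<le> d * (m + 1)"
        unfolding abs_mult using dg[of i] dg[of j] d0 d1 by (intro mult_mono) auto
      moreover have "\<bar>A $ i $ i * (L $ j $ j - A $ j $ j)\<bar> \<le> m * d"
        unfolding abs_mult using dg[of i] dg[of j] m0 by (intro mult_mono) auto
      moreover have "\<bar>principal_minor L {i, j} - principal_minor A {i, j}\<bar> \<le> d" using H by blast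
      ultimately have "(L $ i $ j)\<^sup>2 \<le> (2 * m + 2) * d" by (simp add: algebra_simps)
      then show ?thesis by (metis real_sqrt_abs real_sqrt_le_mono real_sqrt_mult)
    qed
    then have "\<bar>restrict_mat L J J' $ i $ j\<bar> \<le> sqrt (2 * m + 2) * sqrt d" for i j
      using m0 d0 by (simp add: restrict_mat_def)
    from norm_matrix_le[OF this] show "norm (restrict_mat L J J') \<le> C * sqrt d"
      by (simp add: C_def mult.assoc)
  qed
qed

lemma sign_conjugate_nth:
  "((\<chi> i j. if i = j then s i else 0) ** R ** (\<chi> i j. if i = j then s i else 0)) $ i $ j
    = s i * R $ i $ j * (s j :: real)"
  by (simp add: matrix_matrix_mult_def if_distrib[where f = "\<lambda>a. a * _"]
    if_distrib[where f = "\<lambda>a. _ * a"] cong: if_cong)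

text \<open>\<open>minors_determine_entries\<close> in matrix form. The signs move from
  \<open>L\<close> to \<open>A\<close>, which leaves absolute differences unchanged since each sign
  is its own inverse.\<close>

lemma block_bound:
  fixes A :: "real ^ 'n ^ 'n"
  assumes "grown A J" and sym: "transpose A = A"
  shows "\<exists>C\<ge>0. \<forall>L d. transpose L = L \<longrightarrow> d \<le> 1 \<longrightarrow>
    (\<forall>K. \<bar>principal_minor L K - principal_minor A K\<bar> \<le> d) \<longrightarrow>
    (\<exists>D\<in>sign_matrices. norm (restrict_mat L J J - D ** restrict_mat A J J ** D) \<le> C * d)"
proof -
  obtain C where C: "C \<ge> 0" and CB: "\<And>B d. transpose B = B \<Longrightarrow> 0 \<le> d \<Longrightarrow> d \<le> 1 \<Longrightarrow>
    (\<And>K. K \<subseteq> J \<Longrightarrow> \<bar>principal_minor B K - principal_minor A K\<bar> \<le> d) \<Longrightarrow>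
    \<exists>s. (\<forall>i. s i = 1 \<or> s i = -1) \<and> (\<forall>i\<in>J. \<forall>j\<in>J. \<bar>s i * s j * B $ i $ j - A $ i $ j\<bar> \<le> C * d)"
    using minors_determine_entries[OF assms] by blast
  show ?thesis
  proof (intro exI[of _ "real CARD('n) * (real CARD('n) * C)"] conjI allI impI)
    fix L :: "real ^ 'n ^ 'n" and d
    assume sL: "transpose L = L" and d1: "d \<le> 1"
      and H: "\<forall>K. \<bar>principal_minor L K - principal_minor A K\<bar> \<le> d"
    have d0: "0 \<le> d" using H[rule_format, of "{}"] by linarith
    obtain s where s: "\<And>i. s i = 1 \<or> s i = -1"
      and sb: "\<And>i j. i \<in> J \<Longrightarrow> j \<in> J \<Longrightarrow> \<bar>s i * s j * L $ i $ j - A $ i $ j\<bar> \<le> C * d"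
      using CB[OF sL d0 d1 H[rule_format]] by blast
    define D :: "real ^ 'n ^ 'n" where "D = (\<chi> i j. if i = j then s i else 0)"
    have D: "D \<in> sign_matrices" unfolding sign_matrices_def D_def using s by auto
    have "\<bar>(restrict_mat L J J - D ** restrict_mat A J J ** D) $ i $ j\<bar> \<le> C * d" for i j
    proof -
      have "\<bar>L $ i $ j - s i * A $ i $ j * s j\<bar> = \<bar>s i * s j * L $ i $ j - A $ i $ j\<bar>"
        using s[of i] s[of j] by (auto simp: abs_if)
      then show ?thesis unfolding D_def vector_minus_component sign_conjugate_nth
        using sb[of i j] C d0 by (simp add: restrict_mat_def)
    qed
    then have "norm (restrict_mat L J J - D ** restrict_mat A J J ** D)
        \<le> real CARD('n) * (real CARD('n) * (C * d))"
      by (rule norm_matrix_le)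
    with D show "\<exists>D\<in>sign_matrices. norm (restrict_mat L J J - D ** restrict_mat A J J ** D)
        \<le> real CARD('n) * (real CARD('n) * C) * d"
      unfolding mult.assoc by (rule bexI[rotated])
  qed (use C in simp)
qed

subsection \<open>Probabilistic estimates\<close>

definition emp_freq :: "(nat \<Rightarrow> 'a) \<Rightarrow> nat \<Rightarrow> 'a \<Rightarrow> real" where
  "emp_freq z n x = (\<Sum>i=1..n. indicator {x} (z i)) / real n"

lemma sum_emp_freq_mult:
  fixes z :: "nat \<Rightarrow> 'a::finite"
  shows "(\<Sum>x\<in>UNIV. emp_freq z n x * g x) = 1 / real n * (\<Sum>i=1..n. g (z i))"
proof -
  have "(\<Sum>x\<in>UNIV. emp_freq z n x * g x) = 1 / real n * (\<Sum>x\<in>UNIV. \<Sum>i=1..n. indicator {x} (z i) * g x)"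
    unfolding emp_freq_def sum_distrib_left by (simp add: sum_distrib_right sum_divide_distrib)
  also have "(\<Sum>x\<in>UNIV. \<Sum>i=1..n. indicator {x} (z i) * g x) = (\<Sum>i=1..n. \<Sum>x\<in>UNIV. indicator {x} (z i) * g x)"
    by (rule sum.swap)
  also have "\<dots> = (\<Sum>i=1..n. g (z i))"
    by (intro sum.cong refl) (simp add: indicator_def if_distrib[where f = "\<lambda>a. a * _"] cong: if_cong)
  finally show ?thesis .
qed

lemma sum_emp_freq: "n \<ge> 1 \<Longrightarrow> (\<Sum>x\<in>UNIV. emp_freq z n x) = 1" for z :: "nat \<Rightarrow> 'a::finite"
  using sum_emp_freq_mult[of z n "\<lambda>_. 1"] by simp

text \<open>The sample enters only through its frequencies, which become the weights of
  \<open>dpp_loglik_maximizer_exists\<close> and \<open>principal_minors_close\<close>.\<close>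

lemma dpp_loglik_eq: "dpp_loglik z n = (\<lambda>L. \<Sum>K\<in>UNIV. emp_freq z n K * ln (dpp_prob L K))"
  by (rule ext) (simp add: dpp_loglik_def sum_emp_freq_mult)

text \<open>Hoeffding's inequality for the indicators of \<open>Z i \<omega> = x\<close>, which take
  values in the unit interval, after scaling the deviation by \<open>n\<close>.\<close>

lemma (in prob_space) emp_freq_deviation:
  fixes Z :: "nat \<Rightarrow> 'a \<Rightarrow> 'b::finite"
  assumes ind: "indep_vars (\<lambda>_. count_space UNIV) Z {1..}"
    and dist: "\<And>i. i \<ge> 1 \<Longrightarrow> prob {\<omega>\<in>space M. Z i \<omega> = x} = p"
    and n: "n \<ge> 1" and t: "t \<ge> 0"
  shows "prob {\<omega>\<in>space M. \<bar>emp_freq (\<lambda>i. Z i \<omega>) n x - p\<bar> \<ge> t / sqrt n} \<le> 2 * exp (-2 * t\<^sup>2)"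
proof -
  define X where "X i \<omega> = (indicator {x} (Z i \<omega>) :: real)" for i \<omega>
  have "indep_vars (\<lambda>_. borel) X {1..n}"
    unfolding X_def
    by (rule indep_vars_compose2[OF indep_vars_subset[OF ind], where Y = "\<lambda>_. indicator {x}"]) auto
  moreover have "AE \<omega> in M. X i \<omega> \<in> {0..1}" for i by (rule AE_I2) (simp add: X_def indicator_def)
  ultimately interpret H: Hoeffding_ineq M "{1..n}" X "\<lambda>_. 0" "\<lambda>_. 1" "\<Sum>i\<in>{1..n}. expectation (X i)"
    by unfold_locales simp_all
  have EX: "expectation (X i) = p" if "i \<ge> 1" for i
  proof -
    have "X i \<omega> = indicator {\<omega>\<in>space M. Z i \<omega> = x} \<omega>" if "\<omega> \<in> space M" for \<omega>
      using that by (simp add: X_def indicator_def)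
    then have "expectation (X i) = expectation (indicator {\<omega>\<in>space M. Z i \<omega> = x})"
      by (intro Bochner_Integration.integral_cong) auto
    also have "\<dots> = prob {\<omega>\<in>space M. Z i \<omega> = x}" by (simp add: Int_absorb2)
    finally show ?thesis using dist[OF that] by simp
  qed
  have n0: "real n > 0" using n by simp
  have eq: "t / sqrt n \<le> \<bar>emp_freq (\<lambda>i. Z i \<omega>) n x - p\<bar> \<longleftrightarrow> t * sqrt n \<le> \<bar>(\<Sum>i=1..n. X i \<omega>) - n * p\<bar>" for \<omega>
  proof -
    have 1: "(emp_freq (\<lambda>i. Z i \<omega>) n x - p) * n = (\<Sum>i=1..n. X i \<omega>) - n * p"
      using n0 by (simp add: emp_freq_def X_def left_diff_distrib)
    have "t / sqrt n * n = t * (n / sqrt n)" by simp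
    also have "n / sqrt n = sqrt n" by (rule real_div_sqrt) simp
    finally have 2: "t / sqrt n * n = t * sqrt n" .
    have "t / sqrt n \<le> \<bar>emp_freq (\<lambda>i. Z i \<omega>) n x - p\<bar> \<longleftrightarrow>
        t / sqrt n * n \<le> \<bar>emp_freq (\<lambda>i. Z i \<omega>) n x - p\<bar> * \<bar>real n\<bar>"
      using n0 by (simp only: mult_le_cancel_right_pos abs_of_pos)
    then show ?thesis unfolding abs_mult[symmetric] 1 2 .
  qed
  have "prob {\<omega>\<in>space M. \<bar>emp_freq (\<lambda>i. Z i \<omega>) n x - p\<bar> \<ge> t / sqrt n} =
      prob {\<omega>\<in>space M. \<bar>(\<Sum>i\<in>{1..n}. X i \<omega>) - (\<Sum>i\<in>{1..n}. expectation (X i))\<bar> \<ge> t * sqrt n}"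
    using EX by (simp add: eq)
  also have "\<dots> \<le> 2 * exp (-2 * (t * sqrt n)\<^sup>2 / (\<Sum>i\<in>{1..n}. (1 - 0)\<^sup>2))"
    using t n by (intro H.Hoeffding_ineq_abs_ge) auto
  also have "\<dots> = 2 * exp (-2 * t\<^sup>2)" using n0 by (simp add: power_mult_distrib)
  finally show ?thesis .
qed

section \<open>Boundedness in probability and measurability\<close>

lemma (in prob_space) tight:
  fixes X :: "'a \<Rightarrow> real"
  assumes X: "X \<in> borel_measurable M" and e: "e > 0"
  shows "\<exists>K. prob {\<omega>\<in>space M. \<bar>X \<omega>\<bar> > K} \<le> e"
proof -
  define A where "A k = {\<omega>\<in>space M. \<bar>X \<omega>\<bar> > real k}" for k :: nat
  have "range A \<subseteq> sets M" unfolding A_def using X by auto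
  moreover have "decseq A" unfolding A_def by (auto simp: decseq_def)
  ultimately have "(\<lambda>k. prob (A k)) \<longlonglongrightarrow> prob (\<Inter>k. A k)"
    by (rule finite_Lim_measure_decseq)
  moreover have "(\<Inter>k. A k) = {}"
  proof -
    have "\<exists>k. \<omega> \<notin> A k" for \<omega> using reals_Archimedean2[of "\<bar>X \<omega>\<bar>"] unfolding A_def by (auto simp: not_less intro: less_imp_le)
    then show ?thesis by blast
  qed
  ultimately have "(\<lambda>k. prob (A k)) \<longlonglongrightarrow> 0" by simp
  then have "eventually (\<lambda>k. prob (A k) < e) sequentially" using e by (rule order_tendstoD)
  then obtain k where "prob (A k) < e" by (auto simp: eventually_sequentially)
  then show ?thesis unfolding A_def by (intro exI[of _ "real k"]) simp
qed

text \<open>\<open>big_O_prob\<close> asks for one constant for all \<open>n \<ge> 1\<close>, but a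
  bound for large \<open>n\<close> suffices: each of the finitely many others is tight by itself,
  and \<open>K'\<close> is the maximum of all these constants.\<close>

lemma (in prob_space) big_O_probI:
  assumes X: "\<And>n. n \<ge> 1 \<Longrightarrow> X n \<in> borel_measurable M" and r: "\<And>n. n \<ge> 1 \<Longrightarrow> r n > 0"
    and ev: "\<And>e. e > 0 \<Longrightarrow> \<exists>K N. \<forall>n\<ge>N. n \<ge> 1 \<longrightarrow>
      (\<exists>G\<in>events. prob G \<ge> 1 - e \<and> (\<forall>\<omega>\<in>G. \<bar>X n \<omega>\<bar> \<le> K * r n))"
  shows "big_O_prob M X r"
  unfolding big_O_prob_def
proof (intro conjI allI impI X)
  fix e :: real assume e: "e > 0"
  obtain K N where KN: "\<And>n. n \<ge> N \<Longrightarrow> n \<ge> 1 \<Longrightarrow>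
      \<exists>G\<in>events. prob G \<ge> 1 - e \<and> (\<forall>\<omega>\<in>G. \<bar>X n \<omega>\<bar> \<le> K * r n)"
    using ev[OF e] by blast
  have m: "{\<omega>\<in>space M. \<bar>X n \<omega> / r n\<bar> > k} \<in> events" if "n \<ge> 1" for n k
    using X[OF that] by measurable
  define k where "k n = (SOME k. prob {\<omega>\<in>space M. \<bar>X n \<omega> / r n\<bar> > k} \<le> e)" for n
  have k: "prob {\<omega>\<in>space M. \<bar>X n \<omega> / r n\<bar> > k n} \<le> e" if "n \<ge> 1" for n
    unfolding k_def using X[OF that] e by (intro someI_ex[of "\<lambda>k. prob {\<omega>\<in>space M. \<bar>X n \<omega> / r n\<bar> > k} \<le> e"] tight) auto
  define K' where "K' = Max (insert K (k ` {..N}))"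
  have K': "K \<le> K'" "\<And>n. n \<le> N \<Longrightarrow> k n \<le> K'" unfolding K'_def by (rule Max_ge; simp)+
  show "\<exists>K. \<forall>n\<ge>1. prob {\<omega>\<in>space M. \<bar>X n \<omega> / r n\<bar> > K} \<le> e"
  proof (intro exI[of _ K'] allI impI)
    fix n :: nat assume n: "n \<ge> 1"
    show "prob {\<omega>\<in>space M. \<bar>X n \<omega> / r n\<bar> > K'} \<le> e"
    proof (cases "n \<le> N")
      case True
      have "prob {\<omega>\<in>space M. \<bar>X n \<omega> / r n\<bar> > K'} \<le> prob {\<omega>\<in>space M. \<bar>X n \<omega> / r n\<bar> > k n}"
        using K'(2)[OF True] by (intro finite_measure_mono m[OF n]) auto
      then show ?thesis using k[OF n] by linarith
    next
      case False
      then obtain G where G: "G \<in> events" "prob G \<ge> 1 - e" and GX: "\<And>\<omega>. \<omega> \<in> G \<Longrightarrow> \<bar>X n \<omega>\<bar> \<le> K * r n"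
        using KN[of n] n by auto
      have "{\<omega>\<in>space M. \<bar>X n \<omega> / r n\<bar> > K'} \<subseteq> space M - G"
      proof (intro subsetI DiffI)
        fix \<omega> assume w: "\<omega> \<in> {\<omega>\<in>space M. \<bar>X n \<omega> / r n\<bar> > K'}"
        show "\<omega> \<notin> G"
        proof
          assume "\<omega> \<in> G"
          then have "\<bar>X n \<omega> / r n\<bar> \<le> K" using GX r[OF n] by (simp add: field_simps)
          then show False using w K'(1) by auto
        qed
      qed auto
      then have "prob {\<omega>\<in>space M. \<bar>X n \<omega> / r n\<bar> > K'} \<le> prob (space M - G)"
        using G by (intro finite_measure_mono) auto
      then show ?thesis using G prob_compl[of G] by linarith
    qed
  qed
qed

lemma borel_measurable_Min_norm_restrict_mat:
  fixes L :: "'w \<Rightarrow> real ^ 'n ^ 'n" and I :: "'i set"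
  assumes L: "L \<in> borel_measurable M" and I: "finite I"
  shows "(\<lambda>\<omega>. Min ((\<lambda>D. norm (restrict_mat (L \<omega>) J J' - c D)) ` I)) \<in> borel_measurable M"
proof (rule borel_measurable_Min[OF I])
  fix D
  have "continuous_on UNIV (\<lambda>X :: real ^ 'n ^ 'n. if b then X $ i $ j else 0)" for b i j
    by (cases b) (auto intro!: continuous_intros)
  then have "continuous_on UNIV (\<lambda>X :: real ^ 'n ^ 'n. norm (restrict_mat X J J' - c D))"
    unfolding restrict_mat_def by (intro continuous_intros continuous_on_vec_lambda)
  then show "(\<lambda>\<omega>. norm (restrict_mat (L \<omega>) J J' - c D)) \<in> borel_measurable M"
    by (intro measurable_compose[OF L] borel_measurable_continuous_onI)
qed

text \<open>The minors are estimated at the parametric rate although the entries of the matrix are not.\<close>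

lemma (in prob_space) mle_principal_minors_rate:
  fixes A :: "real ^ 'n ^ 'n" and Z :: "nat \<Rightarrow> 'a \<Rightarrow> 'n set" and Lhat :: "nat \<Rightarrow> 'a \<Rightarrow> real ^ 'n ^ 'n"
  assumes A: "A \<in> spd"
    and ind: "indep_vars (\<lambda>_. count_space UNIV) Z {1..}"
    and dist: "\<And>i. i \<ge> 1 \<Longrightarrow> distr M (count_space UNIV) (Z i) = dpp A"
    and mle: "\<And>n. n \<ge> 1 \<Longrightarrow> is_mle M Z n (Lhat n)"
    and eps: "\<epsilon> > 0"
  shows "\<exists>k\<ge>0. \<exists>N. \<forall>n\<ge>N. n \<ge> 1 \<longrightarrow> k / sqrt (real n) \<le> 1 \<and> (\<exists>G\<in>events. prob G \<ge> 1 - \<epsilon> \<and> G \<subseteq> space M \<and>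
    (\<forall>\<omega>\<in>G. \<forall>K. \<bar>principal_minor (Lhat n \<omega>) K - principal_minor A K\<bar> \<le> k / sqrt (real n)))"
proof -
  let ?m = "real CARD('n set)"
  obtain C e0 where C: "C \<ge> 0" and e0: "e0 > 0"
    and close: "\<And>w e K. (\<And>K. \<bar>w K - dpp_prob A K\<bar> \<le> e) \<Longrightarrow> e \<le> e0 \<Longrightarrow> sum w UNIV = 1 \<Longrightarrow> w K > 0"
      "\<And>w e L K. (\<And>K. \<bar>w K - dpp_prob A K\<bar> \<le> e) \<Longrightarrow> e \<le> e0 \<Longrightarrow> sum w UNIV = 1 \<Longrightarrow> L \<in> spd \<Longrightarrow>
      (\<Sum>K\<in>UNIV. w K * ln (dpp_prob A K)) \<le> (\<Sum>K\<in>UNIV. w K * ln (dpp_prob L K)) \<Longrightarrow>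
      \<bar>principal_minor L K - principal_minor A K\<bar> \<le> C * e"
    using principal_minors_close[OF A] by (elim exE conjE) (rule that, blast+)
  have Zm: "Z i \<in> measurable M (count_space UNIV)" if "i \<ge> 1" for i
    using ind that unfolding indep_vars_def by auto
  have pZ: "prob {\<omega>\<in>space M. Z i \<omega> = K} = dpp_prob A K" if i: "i \<ge> 1" for i K
  proof -
    have "emeasure M {\<omega>\<in>space M. Z i \<omega> = K} = emeasure (distr M (count_space UNIV) (Z i)) {K}"
      using Zm[OF i] by (subst emeasure_distr) (auto intro!: arg_cong[where f = "emeasure M"])
    also have "\<dots> = ennreal (dpp_prob A K)"
      unfolding dist[OF i] dpp_def by (subst emeasure_point_measure_finite) auto
    finally show ?thesis using dpp_prob_pos[OF A, of K] by (simp add: measure_def)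
  qed
  \<comment> \<open>Chosen so that the union bound over all subsets, each with Hoeffding tail
    \<open>2 * exp (-2 * t\<^sup>2)\<close>, totals at most \<open>\<epsilon>\<close>; the
    \<open>max\<close> covers a negative logarithm.\<close>
  define t where "t = sqrt (max 0 (ln (2 * ?m / \<epsilon>) / 2))"
  have t0: "t \<ge> 0" by (simp add: t_def)
  have t: "?m * (2 * exp (-2 * t\<^sup>2)) \<le> \<epsilon>"
  proof -
    have "ln (2 * ?m / \<epsilon>) \<le> 2 * t\<^sup>2" by (simp add: t_def)
    then have "exp (-2 * t\<^sup>2) \<le> exp (- ln (2 * ?m / \<epsilon>))" by simp
    also have "\<dots> = \<epsilon> / (2 * ?m)" using eps by (simp add: exp_minus)
    finally show ?thesis by (simp add: field_simps)
  qed
  define k where "k = C * t"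
  have k: "k \<ge> 0" using C t0 by (simp add: k_def)
  have lim: "\<forall>\<^sub>F n in sequentially. a / sqrt (real n) < b" if "b > 0" for a b :: real
  proof -
    have "(\<lambda>n. a / sqrt (real n)) \<longlonglongrightarrow> 0"
      by (intro tendsto_divide_0[OF tendsto_const] filterlim_at_top_imp_at_infinity
        filterlim_compose[OF sqrt_at_top filterlim_real_sequentially])
    then show ?thesis using that by (rule order_tendstoD)
  qed
  \<comment> \<open>Beyond \<open>N\<close>, deviations lie within the threshold \<open>e0\<close>
    and the error of the minors is at most 1, as the entrywise bounds require.\<close>
  obtain N where N: "\<And>n. n \<ge> N \<Longrightarrow> t / sqrt (real n) < e0 \<and> k / sqrt (real n) < 1"
    using eventually_conj[OF lim[OF e0, of t] lim[of 1 k]] unfolding eventually_sequentially by auto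
  show ?thesis
  proof (rule exI[of _ k], intro conjI k, rule exI[of _ N], intro allI impI conjI)
    fix n assume nN: "n \<ge> N" and n: "n \<ge> 1"
    show "k / sqrt (real n) \<le> 1" using N[OF nN] by simp
    define B where "B K = {\<omega>\<in>space M. \<bar>emp_freq (\<lambda>i. Z i \<omega>) n K - dpp_prob A K\<bar> \<ge> t / sqrt (real n)}" for K
    have Bm: "B K \<in> events" for K
    proof -
      have "(\<lambda>\<omega>. emp_freq (\<lambda>i. Z i \<omega>) n K) \<in> borel_measurable M"
        unfolding emp_freq_def using Zm
        by (intro borel_measurable_divide borel_measurable_sum borel_measurable_const
          measurable_compose[OF Zm]) auto
      then show ?thesis unfolding B_def by measurable
    qed
    define G where "G = space M - (\<Union>K. B K)"
    show "\<exists>G\<in>events. prob G \<ge> 1 - \<epsilon> \<and> G \<subseteq> space M \<and>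
        (\<forall>\<omega>\<in>G. \<forall>K. \<bar>principal_minor (Lhat n \<omega>) K - principal_minor A K\<bar> \<le> k / sqrt (real n))"
    proof (intro bexI[of _ G] conjI ballI allI)
      have UB: "(\<Union>K. B K) \<in> events" using Bm by auto
      show "G \<in> events" unfolding G_def using UB by auto
      show "G \<subseteq> space M" unfolding G_def by auto
      have "prob (\<Union>K. B K) \<le> (\<Sum>K\<in>UNIV. prob (B K))"
        using Bm by (intro finite_measure_subadditive_finite) auto
      also have "\<dots> \<le> (\<Sum>K\<in>(UNIV :: 'n set set). 2 * exp (-2 * t\<^sup>2))"
        unfolding B_def using pZ n t0 by (intro sum_mono emp_freq_deviation[OF ind]) auto
      also have "\<dots> \<le> \<epsilon>" using t by simp
      finally show "prob G \<ge> 1 - \<epsilon>" unfolding G_def using prob_compl[OF UB] by linarith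
      fix \<omega> K assume "\<omega> \<in> G"
      then have w: "\<omega> \<in> space M" and
        dev: "\<And>K. \<bar>emp_freq (\<lambda>i. Z i \<omega>) n K - dpp_prob A K\<bar> \<le> t / sqrt (real n)"
        unfolding G_def B_def by (auto simp: not_le intro: less_imp_le)
      let ?w = "emp_freq (\<lambda>i. Z i \<omega>) n"
      note sw = sum_emp_freq[OF n, of "\<lambda>i. Z i \<omega>"]
      have te: "t / sqrt (real n) \<le> e0" using N[OF nN] by simp
      \<comment> \<open>On \<open>G\<close> every subset has been observed, so a maximizer exists
        and the arbitrary value of the estimator is excluded.\<close>
      have "?w K > 0" for K using close(1)[OF dev te sw] .
      from dpp_loglik_maximizer_exists[OF this]
      have "\<exists>L. is_arg_max (dpp_loglik (\<lambda>i. Z i \<omega>) n) (\<lambda>L. L \<in> spd) L"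
        unfolding dpp_loglik_eq .
      then have "is_arg_max (dpp_loglik (\<lambda>i. Z i \<omega>) n) (\<lambda>L. L \<in> spd) (Lhat n \<omega>)"
        using mle[OF n] w unfolding is_mle_def by blast
      then have "Lhat n \<omega> \<in> spd" "dpp_loglik (\<lambda>i. Z i \<omega>) n A \<le> dpp_loglik (\<lambda>i. Z i \<omega>) n (Lhat n \<omega>)"
        using A unfolding is_arg_max_def by (auto simp: not_less)
      then have "\<bar>principal_minor (Lhat n \<omega>) K - principal_minor A K\<bar> \<le> C * (t / sqrt (real n))"
        unfolding dpp_loglik_eq by (intro close(2)[OF dev te sw])
      then show "\<bar>principal_minor (Lhat n \<omega>) K - principal_minor A K\<bar> \<le> k / sqrt (real n)"
        by (simp add: k_def)
    qed
  qed
qed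

section \<open>Rates between blocks and within a block\<close>

theorem theorem8:
  fixes M :: "'w measure"
    and Lstar :: "real ^ 'n ^ 'n"
    and Z :: "nat \<Rightarrow> 'w \<Rightarrow> 'n set"
    and Lhat :: "nat \<Rightarrow> 'w \<Rightarrow> real ^ 'n ^ 'n"
    and P :: "'n set set"
    and J J' :: "'n set"
  assumes "prob_space M"
    and "Lstar \<in> spd"
    and "block_diagonal Lstar"
    and "prob_space.indep_vars M (\<lambda>_. count_space UNIV) Z {1..}"
    and "\<And>i. i \<ge> 1 \<Longrightarrow> distr M (count_space UNIV) (Z i) = dpp Lstar"
    and "\<And>n. n \<ge> 1 \<Longrightarrow> is_mle M Z n (Lhat n)"
    and "are_blocks Lstar P"
    and "J \<in> P" and "J' \<in> P" and "J \<noteq> J'"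
  shows "big_O_prob M
           (\<lambda>n \<omega>. Min ((\<lambda>D. norm (restrict_mat (Lhat n \<omega>) J J'
                                    - D ** restrict_mat Lstar J J' ** D)) ` sign_matrices))
           (\<lambda>n. real n powr (- 1 / 6)) \<and>
         big_O_prob M
           (\<lambda>n \<omega>. Min ((\<lambda>D. norm (restrict_mat (Lhat n \<omega>) J J
                                    - D ** restrict_mat Lstar J J ** D)) ` sign_matrices))
           (\<lambda>n. real n powr (- 1 / 2))"
proof -
  interpret prob_space M by fact
  have sym: "transpose Lstar = Lstar" using assms(2) by (simp add: spd_def)
  have blocks: "block_partition Lstar P" using assms(7) by (simp add: are_blocks_def)
  have dis: "J \<inter> J' = {}"
    using blocks partition_onD2[of UNIV P] disjointD[of P J J'] assms(8-10) by (simp add: block_partition_def)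
  have sep: "Lstar $ i $ j = 0" if "i \<in> J" "j \<in> J'" for i j
    using blocks assms(8-10) that by (auto simp: block_partition_def)
  note meas = borel_measurable_Min_norm_restrict_mat[OF _ finite_sign_matrices]
  have Lm: "Lhat n \<in> borel_measurable M" and Lsym: "\<omega> \<in> space M \<Longrightarrow> transpose (Lhat n \<omega>) = Lhat n \<omega>"
    if "n \<ge> 1" for n \<omega>
    using assms(6)[OF that] unfolding is_mle_def spd_def by auto
  note rate = mle_principal_minors_rate[OF assms(2,4,5,6)]
  have Min_bound: "\<bar>Min ((\<lambda>D. norm (X - c D)) ` sign_matrices)\<bar> \<le> b"
    if "D \<in> sign_matrices" "norm (X - c D) \<le> b" for X :: "real ^ 'n ^ 'n" and c D b
  proof -
    have "0 \<le> Min ((\<lambda>D. norm (X - c D)) ` sign_matrices)"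
      using finite_sign_matrices that(1) by (subst Min_ge_iff) auto
    moreover have "Min ((\<lambda>D. norm (X - c D)) ` sign_matrices) \<le> norm (X - c D)"
      using finite_sign_matrices that(1) by (intro Min_le) auto
    ultimately show ?thesis using that(2) by linarith
  qed
  show ?thesis
  proof (intro conjI big_O_probI)
    fix e :: real assume e: "e > 0"
    obtain C where C: "C \<ge> 0" and CL: "\<And>L d. transpose L = L \<Longrightarrow> d \<le> 1 \<Longrightarrow>
        (\<And>K. \<bar>principal_minor L K - principal_minor Lstar K\<bar> \<le> d) \<Longrightarrow>
        norm (restrict_mat L J J') \<le> C * sqrt d"
      using off_block_bound[OF sym dis sep] by blast
    obtain k N where k: "k \<ge> 0" and kN: "\<And>n. n \<ge> N \<Longrightarrow> n \<ge> 1 \<Longrightarrow> k / sqrt (real n) \<le> 1 \<and>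
       (\<exists>G\<in>events. prob G \<ge> 1 - e \<and> G \<subseteq> space M \<and>
         (\<forall>\<omega>\<in>G. \<forall>K. \<bar>principal_minor (Lhat n \<omega>) K - principal_minor Lstar K\<bar> \<le> k / sqrt (real n)))"
      using rate[OF _ _ e] by blast
    show "\<exists>K N. \<forall>n\<ge>N. n \<ge> 1 \<longrightarrow> (\<exists>G\<in>events. prob G \<ge> 1 - e \<and> (\<forall>\<omega>\<in>G.
        \<bar>Min ((\<lambda>D. norm (restrict_mat (Lhat n \<omega>) J J' - D ** restrict_mat Lstar J J' ** D)) ` sign_matrices)\<bar>
        \<le> K * real n powr (- 1 / 6)))"
    proof (rule exI[of _ "C * sqrt k"], rule exI[of _ N], intro allI impI)
      fix n assume nN: "n \<ge> N" and n: "n \<ge> 1"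
      obtain G where G: "G \<in> events" "prob G \<ge> 1 - e" "G \<subseteq> space M" and Gk: "\<And>\<omega> K. \<omega> \<in> G \<Longrightarrow>
          \<bar>principal_minor (Lhat n \<omega>) K - principal_minor Lstar K\<bar> \<le> k / sqrt (real n)"
        using kN[OF nN n] by blast
      have "\<bar>Min ((\<lambda>D. norm (restrict_mat (Lhat n \<omega>) J J' - D ** restrict_mat Lstar J J' ** D)) ` sign_matrices)\<bar>
          \<le> C * sqrt k * real n powr (- 1 / 6)" if w: "\<omega> \<in> G" for \<omega>
      \<comment> \<open>The target is zero between blocks, so all sign matrices give the same norm
        and \<open>mat 1\<close> represents them.\<close>
      proof (rule Min_bound[OF sign_matrices_nonempty])
        have z: "restrict_mat Lstar J J' = 0" using sep by (simp add: restrict_mat_def vec_eq_iff)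
        \<comment> \<open>The square root of the parametric rate has exponent -1/4, which is relaxed
          to -1/6 using \<open>n \<ge> 1\<close>.\<close>
        have "sqrt (k / sqrt (real n)) = sqrt k * real n powr (- 1 / 4)"
          using n by (simp add: real_sqrt_divide powr_half_sqrt[symmetric] powr_powr powr_minus_divide)
        also have "\<dots> \<le> sqrt k * real n powr (- 1 / 6)"
          using n k by (intro mult_left_mono powr_mono) auto
        finally have "C * sqrt (k / sqrt (real n)) \<le> C * (sqrt k * real n powr (- 1 / 6))"
          using C by (rule mult_left_mono)
        moreover have "norm (restrict_mat (Lhat n \<omega>) J J') \<le> C * sqrt (k / sqrt (real n))"
          using Lsym[OF n] kN[OF nN n] Gk[OF w] w G(3) by (intro CL) auto
        ultimately show "norm (restrict_mat (Lhat n \<omega>) J J' - mat 1 ** restrict_mat Lstar J J' ** mat 1)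
            \<le> C * sqrt k * real n powr (- 1 / 6)"
          by (simp add: z mult.assoc)
      qed
      then show "\<exists>G\<in>events. prob G \<ge> 1 - e \<and> (\<forall>\<omega>\<in>G.
        \<bar>Min ((\<lambda>D. norm (restrict_mat (Lhat n \<omega>) J J' - D ** restrict_mat Lstar J J' ** D)) ` sign_matrices)\<bar>
        \<le> C * sqrt k * real n powr (- 1 / 6))"
        using G by blast
    qed
  next
    fix e :: real assume e: "e > 0"
    obtain C where C: "C \<ge> 0" and CL: "\<And>L d. transpose L = L \<Longrightarrow> d \<le> 1 \<Longrightarrow>
        (\<And>K. \<bar>principal_minor L K - principal_minor Lstar K\<bar> \<le> d) \<Longrightarrow>
        \<exists>D\<in>sign_matrices. norm (restrict_mat L J J - D ** restrict_mat Lstar J J ** D) \<le> C * d"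
      using block_bound[OF block_grown[OF assms(7,8) sym] sym] by blast
    obtain k N where k: "k \<ge> 0" and kN: "\<And>n. n \<ge> N \<Longrightarrow> n \<ge> 1 \<Longrightarrow> k / sqrt (real n) \<le> 1 \<and>
       (\<exists>G\<in>events. prob G \<ge> 1 - e \<and> G \<subseteq> space M \<and>
         (\<forall>\<omega>\<in>G. \<forall>K. \<bar>principal_minor (Lhat n \<omega>) K - principal_minor Lstar K\<bar> \<le> k / sqrt (real n)))"
      using rate[OF _ _ e] by blast
    show "\<exists>K N. \<forall>n\<ge>N. n \<ge> 1 \<longrightarrow> (\<exists>G\<in>events. prob G \<ge> 1 - e \<and> (\<forall>\<omega>\<in>G.
        \<bar>Min ((\<lambda>D. norm (restrict_mat (Lhat n \<omega>) J J - D ** restrict_mat Lstar J J ** D)) ` sign_matrices)\<bar>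
        \<le> K * real n powr (- 1 / 2)))"
    proof (rule exI[of _ "C * k"], rule exI[of _ N], intro allI impI)
      fix n assume nN: "n \<ge> N" and n: "n \<ge> 1"
      obtain G where G: "G \<in> events" "prob G \<ge> 1 - e" "G \<subseteq> space M" and Gk: "\<And>\<omega> K. \<omega> \<in> G \<Longrightarrow>
          \<bar>principal_minor (Lhat n \<omega>) K - principal_minor Lstar K\<bar> \<le> k / sqrt (real n)"
        using kN[OF nN n] by blast
      have "\<bar>Min ((\<lambda>D. norm (restrict_mat (Lhat n \<omega>) J J - D ** restrict_mat Lstar J J ** D)) ` sign_matrices)\<bar>
          \<le> C * k * real n powr (- 1 / 2)" if w: "\<omega> \<in> G" for \<omega>
      proof -
        have "\<exists>D\<in>sign_matrices. norm (restrict_mat (Lhat n \<omega>) J J - D ** restrict_mat Lstar J J ** D)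
            \<le> C * (k / sqrt (real n))"
          using Lsym[OF n] kN[OF nN n] Gk[OF w] w G(3) by (intro CL) auto
        \<comment> \<open>The matrix \<open>D\<close> may vary with the outcome and with
          \<open>n\<close>; the minimum absorbs this dependence.\<close>
        then obtain D where D: "D \<in> sign_matrices"
          "norm (restrict_mat (Lhat n \<omega>) J J - D ** restrict_mat Lstar J J ** D) \<le> C * (k / sqrt (real n))"
          by blast
        moreover have "C * (k / sqrt (real n)) = C * k * real n powr (- 1 / 2)"
          using n by (simp add: powr_half_sqrt[symmetric] powr_minus_divide)
        ultimately show ?thesis by (intro Min_bound[OF D(1)]) simp
      qed
      then show "\<exists>G\<in>events. prob G \<ge> 1 - e \<and> (\<forall>\<omega>\<in>G.
        \<bar>Min ((\<lambda>D. norm (restrict_mat (Lhat n \<omega>) J J - D ** restrict_mat Lstar J J ** D)) ` sign_matrices)\<bar>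
        \<le> C * k * real n powr (- 1 / 2))"
        using G by blast
    qed
  qed (use Lm in \<open>auto intro!: meas\<close>)
qed

end
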